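(* Let $R_{abcd}$ be a Riemann-symmetric tensor of totally zero weight on a Euclidean-signature space of dimension $D=2n+\varepsilon$, so that $$R=\sum_{\mu<\nu}\left[\Omega_{\mu\nu}(h_\mu\odot h_\nu)+\alpha_{\mu\nu}(Q_\mu\odot Q_\nu)\right]+\sum_\mu\left[\tfrac12\Omega_{\mu\mu}(h_\mu\odot h_\mu)+\alpha^{(\epsilon)}_\mu(Q_\mu\odot Q_\epsilon)\right]$$ for some scalar coefficients $\Omega_{\mu\nu},\alpha_{\mu\nu},\alpha^{(\epsilon)}_\mu$. Let $H_{ab}$ be a 2-form (antisymmetric 2-tensor) constructed from covariant monomials in $R$, i.e. a linear combination of 2-tensors each of which is obtained from a tensor product $R_{a_1b_1c_1d_1}\cdots R_{a_kb_kc_kd_k}$ of some number $k\ge1$ of copies of $R$ by contracting, in pairs and with the metric, all but two of the indices. Then $H_{ab}\equiv0$.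
   Context: Greek indices run over $1,\dots,n$; repeated Greek indices are not summed unless a sum is written. $\varepsilon\in\{0,1\}$. There is an orthonormal coframe $e^\mu,\hat e^\mu$ ($\mu=1,\dots,n$) and, if $\varepsilon=1$, $\hat e^0$, for the metric $g$. Put $h_\mu=e^\mu\otimes\hat e^\mu-\hat e^\mu\otimes e^\mu$, $Q_\mu=e^\mu\otimes e^\mu+\hat e^\mu\otimes\hat e^\mu$, $Q_\epsilon=\varepsilon g$. For antisymmetric $h,f$: $$(h\odot f)_{abcd}=\tfrac14h_{ab}f_{cd}+\tfrac14f_{ab}h_{cd}+\tfrac18h_{ac}f_{bd}+\tfrac18f_{ac}h_{bd}-\tfrac18h_{ad}f_{bc}-\tfrac18f_{ad}h_{bc};$$ for symmetric $Q,k$: $$(Q\odot k)_{abcd}=\tfrac18Q_{ad}k_{bc}+\tfrac18k_{ad}Q_{bc}-\tfrac18Q_{ac}k_{bd}-\tfrac18k_{ac}Q_{bd}.$$ A Riemann-symmetric tensor is a 4-tensor with $r_{abcd}=r_{[ab][cd]}=r_{cdab}$ and $r_{a[bcd]}=0$. Totally zero weight means: with $e^{\pm\mu}=e^\mu\pm i\hat e^\mu$, the tensor is a linear combination of tensor monomials in $e^{\pm\mu},\hat e^0$ in which, for each $\mu$, the number of factors $e^{+\mu}$ equals the number of factors $e^{-\mu}$; the Riemann-symmetric tensors with this property are exactly those of the form displayed in the claim. *)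

theory Defs
  imports "HOL-Analysis.Analysis" "HOL-Library.Disjoint_Sets"
begin

text \<open>
  Everything is pointwise: the type \<open>'a\<close> is the tangent space at a point and \<open>\<bullet>\<close> is the metric \<open>g\<close>.
  A covariant tensor is a multilinear map, its abstract indices being the argument slots.
  The coframe is represented through the metric by the dual orthonormal frame, so
  \<open>e\<^sup>\<mu>\<close> is \<open>\<lambda>x. e \<mu> \<bullet> x\<close>; \<open>e'\<close> stands for the hatted elements, with \<open>e' 0\<close> used only if \<open>\<epsilon> = 1\<close>.
\<close>

type_synonym 'a tensor2 = "'a \<Rightarrow> 'a \<Rightarrow> real"
type_synonym 'a tensor4 = "'a \<Rightarrow> 'a \<Rightarrow> 'a \<Rightarrow> 'a \<Rightarrow> real"

definition hat_range :: "nat \<Rightarrow> nat \<Rightarrow> nat set" where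
  "hat_range n \<epsilon> = (if \<epsilon> = 0 then {1..n} else {0..n})"

definition orthonormal_frame ::
    "nat \<Rightarrow> nat \<Rightarrow> (nat \<Rightarrow> 'a::euclidean_space) \<Rightarrow> (nat \<Rightarrow> 'a) \<Rightarrow> bool" where
  "orthonormal_frame n \<epsilon> e e' \<longleftrightarrow>
     DIM('a) = 2 * n + \<epsilon> \<and>
     (\<forall>\<mu>\<in>{1..n}. \<forall>\<nu>\<in>{1..n}. e \<mu> \<bullet> e \<nu> = (if \<mu> = \<nu> then 1 else 0)) \<and>
     (\<forall>\<mu>\<in>hat_range n \<epsilon>. \<forall>\<nu>\<in>hat_range n \<epsilon>. e' \<mu> \<bullet> e' \<nu> = (if \<mu> = \<nu> then 1 else 0)) \<and>
     (\<forall>\<mu>\<in>{1..n}. \<forall>\<nu>\<in>hat_range n \<epsilon>. e \<mu> \<bullet> e' \<nu> = 0)"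

definition multilinear4 :: "'a::real_vector tensor4 \<Rightarrow> bool" where
  "multilinear4 r \<longleftrightarrow>
     (\<forall>b c d. linear (\<lambda>a. r a b c d)) \<and> (\<forall>a c d. linear (\<lambda>b. r a b c d)) \<and>
     (\<forall>a b d. linear (\<lambda>c. r a b c d)) \<and> (\<forall>a b c. linear (\<lambda>d. r a b c d))"

text \<open>The conditions are \<open>r\<^bsub>abcd\<^esub> = r\<^bsub>[ab][cd]\<^esub> = r\<^bsub>cdab\<^esub>\<close> and \<open>r\<^bsub>a[bcd]\<^esub> = 0\<close>.\<close>

definition riemann_symmetric :: "'a::real_vector tensor4 \<Rightarrow> bool" where
  "riemann_symmetric r \<longleftrightarrow> multilinear4 r \<and>
     (\<forall>a b c d.
        r a b c d = (r a b c d - r b a c d - r a b d c + r b a d c) / 4 \<and>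
        r a b c d = r c d a b \<and>
        (r a b c d + r a c d b + r a d b c - r a b d c - r a c b d - r a d c b) / 6 = 0)"

text \<open>The labels of \<open>e\<^sup>+\<^sup>\<mu>\<close>, \<open>e\<^sup>-\<^sup>\<mu>\<close> and the hatted \<open>e\<^sup>0\<close>.\<close>

datatype factor = Plus nat | Minus nat | Zero

definition factors :: "nat \<Rightarrow> nat \<Rightarrow> factor set" where
  "factors n \<epsilon> = Plus ` {1..n} \<union> Minus ` {1..n} \<union> (if \<epsilon> = 0 then {} else {Zero})"

fun factor_form ::
    "(nat \<Rightarrow> 'a::real_inner) \<Rightarrow> (nat \<Rightarrow> 'a) \<Rightarrow> factor \<Rightarrow> 'a \<Rightarrow> complex" where
  "factor_form e e' (Plus \<mu>) x = of_real (e \<mu> \<bullet> x) + \<i> * of_real (e' \<mu> \<bullet> x)"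
| "factor_form e e' (Minus \<mu>) x = of_real (e \<mu> \<bullet> x) - \<i> * of_real (e' \<mu> \<bullet> x)"
| "factor_form e e' Zero x = of_real (e' 0 \<bullet> x)"

definition balanced_monomials :: "nat \<Rightarrow> nat \<Rightarrow> factor list set" where
  "balanced_monomials n \<epsilon> =
     {w. length w = 4 \<and> set w \<subseteq> factors n \<epsilon> \<and>
         (\<forall>\<mu>\<in>{1..n}. count_list w (Plus \<mu>) = count_list w (Minus \<mu>))}"

text \<open>The balanced monomials are finite in number, so one sum over all of them with arbitrary
  complex coefficients is an arbitrary linear combination.\<close>

definition totally_zero_weight ::
    "nat \<Rightarrow> nat \<Rightarrow> (nat \<Rightarrow> 'a::real_inner) \<Rightarrow> (nat \<Rightarrow> 'a) \<Rightarrow> 'a tensor4 \<Rightarrow> bool" where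
  "totally_zero_weight n \<epsilon> e e' r \<longleftrightarrow>
     (\<exists>z :: factor list \<Rightarrow> complex. \<forall>a b c d.
        complex_of_real (r a b c d) =
          (\<Sum>w\<in>balanced_monomials n \<epsilon>.
             z w * factor_form e e' (w ! 0) a * factor_form e e' (w ! 1) b
                 * factor_form e e' (w ! 2) c * factor_form e e' (w ! 3) d))"

definition h_form :: "(nat \<Rightarrow> 'a::real_inner) \<Rightarrow> (nat \<Rightarrow> 'a) \<Rightarrow> nat \<Rightarrow> 'a tensor2" where
  "h_form e e' \<mu> a b = (e \<mu> \<bullet> a) * (e' \<mu> \<bullet> b) - (e' \<mu> \<bullet> a) * (e \<mu> \<bullet> b)"

definition Q_form :: "(nat \<Rightarrow> 'a::real_inner) \<Rightarrow> (nat \<Rightarrow> 'a) \<Rightarrow> nat \<Rightarrow> 'a tensor2" where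
  "Q_form e e' \<mu> a b = (e \<mu> \<bullet> a) * (e \<mu> \<bullet> b) + (e' \<mu> \<bullet> a) * (e' \<mu> \<bullet> b)"

definition Q_eps :: "nat \<Rightarrow> 'a::real_inner tensor2" where
  "Q_eps \<epsilon> a b = real \<epsilon> * (a \<bullet> b)"

definition odot_antisym :: "'a tensor2 \<Rightarrow> 'a tensor2 \<Rightarrow> 'a tensor4" where
  "odot_antisym h f a b c d =
     1/4 * h a b * f c d + 1/4 * f a b * h c d
     + 1/8 * h a c * f b d + 1/8 * f a c * h b d
     - 1/8 * h a d * f b c - 1/8 * f a d * h b c"

definition odot_sym :: "'a tensor2 \<Rightarrow> 'a tensor2 \<Rightarrow> 'a tensor4" where
  "odot_sym Q k a b c d =
     1/8 * Q a d * k b c + 1/8 * k a d * Q b c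
     - 1/8 * Q a c * k b d - 1/8 * k a c * Q b d"

definition zero_weight_form ::
    "nat \<Rightarrow> nat \<Rightarrow> (nat \<Rightarrow> 'a::real_inner) \<Rightarrow> (nat \<Rightarrow> 'a) \<Rightarrow>
     (nat \<Rightarrow> nat \<Rightarrow> real) \<Rightarrow> (nat \<Rightarrow> nat \<Rightarrow> real) \<Rightarrow> (nat \<Rightarrow> real) \<Rightarrow> 'a tensor4" where
  "zero_weight_form n \<epsilon> e e' \<Omega> \<alpha> \<alpha>\<^sub>\<epsilon> a b c d =
     (\<Sum>\<mu>\<in>{1..n}. \<Sum>\<nu>\<in>{\<mu><..n}.
        \<Omega> \<mu> \<nu> * odot_antisym (h_form e e' \<mu>) (h_form e e' \<nu>) a b c d
        + \<alpha> \<mu> \<nu> * odot_sym (Q_form e e' \<mu>) (Q_form e e' \<nu>) a b c d)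
     + (\<Sum>\<mu>\<in>{1..n}.
        1/2 * \<Omega> \<mu> \<mu> * odot_antisym (h_form e e' \<mu>) (h_form e e' \<mu>) a b c d
        + \<alpha>\<^sub>\<epsilon> \<mu> * odot_sym (Q_form e e' \<mu>) (Q_eps \<epsilon>) a b c d)"

text \<open>
  In a product of \<open>k\<close> copies of \<open>R\<close> the indices are numbered \<open>0, \<dots>, 4k - 1\<close>, copy \<open>j\<close>
  carrying \<open>4j, \<dots>, 4j + 3\<close>. The indices \<open>p\<close> and \<open>q\<close> stay free; \<open>P\<close> is the set of contracted pairs.
  Since \<open>Basis\<close> is orthonormal, contracting a pair with the metric means putting the same basis
  vector \<open>s B\<close> into both slots of the pair \<open>B\<close> and summing.
\<close>

definition pairing :: "nat set \<Rightarrow> nat set set \<Rightarrow> bool" where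
  "pairing A P \<longleftrightarrow> partition_on A P \<and> (\<forall>B\<in>P. card B = 2)"

definition slot_vector ::
    "nat \<Rightarrow> nat \<Rightarrow> nat set set \<Rightarrow> 'a \<Rightarrow> 'a \<Rightarrow> (nat set \<Rightarrow> 'a) \<Rightarrow> nat \<Rightarrow> 'a" where
  "slot_vector p q P a b s i =
     (if i = p then a else if i = q then b else s (THE B. B \<in> P \<and> i \<in> B))"

definition contracted_product ::
    "'a::euclidean_space tensor4 \<Rightarrow> nat \<Rightarrow> nat \<Rightarrow> nat \<Rightarrow> nat set set \<Rightarrow> 'a tensor2" where
  "contracted_product R k p q P a b =
     (\<Sum>s\<in>P \<rightarrow>\<^sub>E Basis. \<Prod>j<k.
        R (slot_vector p q P a b s (4 * j)) (slot_vector p q P a b s (4 * j + 1))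
          (slot_vector p q P a b s (4 * j + 2)) (slot_vector p q P a b s (4 * j + 3)))"

definition covariant_monomial :: "'a::euclidean_space tensor4 \<Rightarrow> 'a tensor2 \<Rightarrow> bool" where
  "covariant_monomial R M \<longleftrightarrow>
     (\<exists>k p q P. k \<ge> 1 \<and> p < 4 * k \<and> q < 4 * k \<and> p \<noteq> q \<and>
        pairing ({..<4 * k} - {p, q}) P \<and> M = contracted_product R k p q P)"

definition constructed_from :: "'a::euclidean_space tensor4 \<Rightarrow> 'a tensor2 \<Rightarrow> bool" where
  "constructed_from R H \<longleftrightarrow>
     (\<exists>(m::nat) (c :: nat \<Rightarrow> real) M. (\<forall>i<m. covariant_monomial R (M i)) \<and>
        (\<forall>a b. H a b = (\<Sum>i<m. c i * M i a b)))"

definition antisymmetric2 :: "'a tensor2 \<Rightarrow> bool" where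
  "antisymmetric2 H \<longleftrightarrow> (\<forall>a b. H a b = - H b a)"

end

theory Submission imports Defs begin

text \<open>
  The argument is one of symmetry. Contraction with the metric commutes with orthogonal
  transformations, so a 2-tensor built from \<open>R\<close> by contraction is invariant under every orthogonal
  transformation that fixes \<open>R\<close> (\<open>constructed_from_invariant\<close>). Two kinds of transformation fix \<open>R\<close>.

  The quarter turn \<open>J\<^sub>\<mu>\<close> of the plane of \<open>e\<^sup>\<mu>, e'\<^sup>\<mu>\<close> multiplies \<open>e\<^sup>+\<^sup>\<mu>\<close> by \<open>\<i>\<close> and \<open>e\<^sup>-\<^sup>\<mu>\<close> by \<open>-\<i>\<close>, so it fixes
  every balanced monomial (\<open>preserves_quarter_turn_balanced\<close>). Its square is \<open>-1\<close> on that plane and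
  \<open>1\<close> on the orthogonal complement, so an invariant 2-tensor has no components between different
  planes, nor between a plane and the hatted direction \<open>0\<close>. If it is moreover antisymmetric, only the components
  \<open>H(e\<^sub>\<mu>, e'\<^sub>\<mu>)\<close> are left.

  The reflection \<open>e'\<^sup>\<mu> \<mapsto> -e'\<^sup>\<mu>\<close>, made for all \<open>\<mu> \<ge> 1\<close> at once, changes the sign of every \<open>h\<^sub>\<mu>\<close> and fixes
  every \<open>Q\<^sub>\<mu>\<close>. The displayed form of \<open>R\<close> is quadratic in the \<open>h\<^sub>\<mu>\<close>, so the reflection fixes it,
  whereas it reverses the sign of \<open>H(e\<^sub>\<mu>, e'\<^sub>\<mu>)\<close>. Hence \<open>H = 0\<close>. The reflection exchanges
  \<open>e\<^sup>+\<^sup>\<mu>\<close> and \<open>e\<^sup>-\<^sup>\<mu>\<close> and moves balanced monomials, so that \<open>R\<close> is fixed by it is a consequence of the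
  Riemann symmetries, which enter through the displayed form.

  The displayed form itself (\<open>zero_weight_form_exists\<close>) follows from a count of components. By
  \<open>curvature_eq_0\<close>, a Riemann-symmetric tensor that is invariant under the quarter turns vanishes as
  soon as its components of the types \<open>(e\<^sub>\<mu>, e'\<^sub>\<mu>, e\<^sub>\<mu>, e'\<^sub>\<mu>)\<close>, \<open>(e\<^sub>\<mu>, e'\<^sub>\<mu>, e\<^sub>\<nu>, e'\<^sub>\<nu>)\<close>,
  \<open>(e\<^sub>\<mu>, e\<^sub>\<nu>, e\<^sub>\<mu>, e\<^sub>\<nu>)\<close> and \<open>(e\<^sub>\<mu>, e'\<^sub>0, e\<^sub>\<mu>, e'\<^sub>0)\<close> do. On these components the displayed form is a triangular
  linear function of \<open>\<Omega>, \<alpha>, \<alpha>\<^sub>\<epsilon>\<close>, so the coefficients can be chosen to match \<open>R\<close>.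
\<close>

section \<open>Riemann-symmetric tensors\<close>

lemma riemann_symmetric_iff:
  "riemann_symmetric r \<longleftrightarrow> multilinear4 r \<and>
     (\<forall>a b c d. r b a c d = - r a b c d \<and> r a b d c = - r a b c d \<and> r c d a b = r a b c d \<and>
        r a b c d + r a c d b + r a d b c = 0)"
proof (intro iffI; (intro conjI allI)?)
  assume r: "riemann_symmetric r"
  then show "multilinear4 r" by (simp add: riemann_symmetric_def)
  fix a b c d
  have avg: "r a b c d = (r a b c d - r b a c d - r a b d c + r b a d c) / 4" for a b c d
    using r unfolding riemann_symmetric_def by blast
  have pair: "r a b c d = r c d a b" for a b c d
    using r unfolding riemann_symmetric_def by blast
  have cyc: "(r a b c d + r a c d b + r a d b c - r a b d c - r a c b d - r a d c b) / 6 = 0" for a b c d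
    using r unfolding riemann_symmetric_def by blast
  have skew1: "r b a c d = - r a b c d" for a b c d
    using avg[of a b c d] avg[of b a c d] by (simp add: field_simps)
  have skew2: "r a b d c = - r a b c d" for a b c d
    using avg[of a b c d] avg[of a b d c] by (simp add: field_simps)
  show "r b a c d = - r a b c d" by (rule skew1)
  show "r a b d c = - r a b c d" by (rule skew2)
  show "r c d a b = r a b c d" by (rule pair)
  show "r a b c d + r a c d b + r a d b c = 0"
    using cyc[of a b c d] skew2[of a b c d] skew2[of a c b d] skew2[of a d b c] by simp
next
  assume r: "multilinear4 r \<and>
     (\<forall>a b c d. r b a c d = - r a b c d \<and> r a b d c = - r a b c d \<and> r c d a b = r a b c d \<and>
        r a b c d + r a c d b + r a d b c = 0)"
  show "riemann_symmetric r"
    unfolding riemann_symmetric_def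
  proof (intro conjI allI)
    show "multilinear4 r" using r by blast
    fix a b c d
    have skew1: "r b a c d = - r a b c d" and skew2: "r a b d c = - r a b c d"
      and pair: "r c d a b = r a b c d" and cyc: "r a b c d + r a c d b + r a d b c = 0" for a b c d
      using r by blast+
    show "r a b c d = (r a b c d - r b a c d - r a b d c + r b a d c) / 4"
      using skew1[of a b c d] skew1[of a b d c] skew2[of a b c d] by simp
    show "r a b c d = r c d a b" by (rule pair[symmetric])
    show "(r a b c d + r a c d b + r a d b c - r a b d c - r a c b d - r a d c b) / 6 = 0"
      using cyc[of a b c d] skew2[of a b c d] skew2[of a c b d] skew2[of a d b c] by simp
  qed
qed

lemma riemann_symmetricD:
  assumes "riemann_symmetric r"
  shows "multilinear4 r" "r b a c d = - r a b c d" "r a b d c = - r a b c d"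
    "r c d a b = r a b c d" "r a b c d + r a c d b + r a d b c = 0"
  using assms unfolding riemann_symmetric_iff by blast+

lemma riemann_symmetricI:
  assumes "multilinear4 r" "\<And>a b c d. r b a c d = - r a b c d" "\<And>a b c d. r a b d c = - r a b c d"
    "\<And>a b c d. r c d a b = r a b c d" "\<And>a b c d. r a b c d + r a c d b + r a d b c = 0"
  shows "riemann_symmetric r"
  using assms unfolding riemann_symmetric_iff by blast

lemma linear_mult_const: "linear f \<Longrightarrow> linear (\<lambda>x. k * f x)" for f :: "'a::real_vector \<Rightarrow> real"
  by (simp add: linear_iff distrib_left)

lemma riemann_symmetric_add:
  assumes r: "riemann_symmetric r" and s: "riemann_symmetric s"
  shows "riemann_symmetric (\<lambda>a b c d. r a b c d + s a b c d)"
proof (rule riemann_symmetricI)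
  show "multilinear4 (\<lambda>a b c d. r a b c d + s a b c d)"
    using riemann_symmetricD(1)[OF r] riemann_symmetricD(1)[OF s] unfolding multilinear4_def
    by (intro conjI allI linear_compose_add) simp_all
  fix a b c d
  show "r b a c d + s b a c d = - (r a b c d + s a b c d)"
    using riemann_symmetricD(2)[OF r, of a b c d] riemann_symmetricD(2)[OF s, of a b c d] by simp
  show "r a b d c + s a b d c = - (r a b c d + s a b c d)"
    using riemann_symmetricD(3)[OF r, of a b c d] riemann_symmetricD(3)[OF s, of a b c d] by simp
  show "r c d a b + s c d a b = r a b c d + s a b c d"
    using riemann_symmetricD(4)[OF r, of a b c d] riemann_symmetricD(4)[OF s, of a b c d] by simp
  show "r a b c d + s a b c d + (r a c d b + s a c d b) + (r a d b c + s a d b c) = 0"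
    using riemann_symmetricD(5)[OF r, of a b c d] riemann_symmetricD(5)[OF s, of a b c d] by simp
qed

lemma riemann_symmetric_scale:
  assumes r: "riemann_symmetric r"
  shows "riemann_symmetric (\<lambda>a b c d. k * r a b c d)"
proof (rule riemann_symmetricI)
  show "multilinear4 (\<lambda>a b c d. k * r a b c d)"
    using riemann_symmetricD(1)[OF r] unfolding multilinear4_def
    by (intro conjI allI linear_mult_const) simp_all
  fix a b c d
  show "k * r b a c d = - (k * r a b c d)"
    using riemann_symmetricD(2)[OF r, of a b c d] by simp
  show "k * r a b d c = - (k * r a b c d)"
    using riemann_symmetricD(3)[OF r, of a b c d] by simp
  show "k * r c d a b = k * r a b c d"
    using riemann_symmetricD(4)[OF r, of a b c d] by simp
  show "k * r a b c d + k * r a c d b + k * r a d b c = 0"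
    using riemann_symmetricD(5)[OF r, of a b c d] by (simp flip: distrib_left)
qed

lemma riemann_symmetric_zero: "riemann_symmetric (\<lambda>a b c d. 0)"
  by (simp add: riemann_symmetric_iff multilinear4_def linear_iff)

lemma riemann_symmetric_sum:
  assumes "\<And>i. i \<in> I \<Longrightarrow> riemann_symmetric (r i)"
  shows "riemann_symmetric (\<lambda>a b c d. \<Sum>i\<in>I. r i a b c d)"
proof (cases "finite I")
  case True
  then show ?thesis
    using assms by induction (auto intro: riemann_symmetric_add riemann_symmetric_zero)
qed (simp add: riemann_symmetric_zero)

text \<open>
  In the cyclic sum the product \<open>h\<^sub>a\<^sub>b f\<^sub>c\<^sub>d\<close> occurs with coefficients \<open>1/4\<close>, \<open>-1/8\<close> and \<open>-1/8\<close>; the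
  weights in the definition of the product are the ones for which the Bianchi identity holds.
\<close>

lemma riemann_symmetric_odot_antisym:
  assumes "bilinear h" "bilinear f" and h: "\<And>a b. h b a = - h a b" and f: "\<And>a b. f b a = - f a b"
  shows "riemann_symmetric (odot_antisym h f)"
  unfolding riemann_symmetric_iff
proof (intro conjI allI)
  note lin = bilinear_ladd[OF assms(1)] bilinear_radd[OF assms(1)] bilinear_ladd[OF assms(2)]
    bilinear_radd[OF assms(2)] bilinear_lmul[OF assms(1)] bilinear_rmul[OF assms(1)]
    bilinear_lmul[OF assms(2)] bilinear_rmul[OF assms(2)]
  show "multilinear4 (odot_antisym h f)"
    unfolding multilinear4_def linear_iff odot_antisym_def by (simp add: lin algebra_simps add_divide_distrib)
  fix a b c d
  show "odot_antisym h f b a c d = - odot_antisym h f a b c d"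
    unfolding odot_antisym_def h[of a b] f[of a b] by (simp add: algebra_simps)
  show "odot_antisym h f a b d c = - odot_antisym h f a b c d"
    unfolding odot_antisym_def h[of c d] f[of c d] by (simp add: algebra_simps)
  show "odot_antisym h f c d a b = odot_antisym h f a b c d"
    unfolding odot_antisym_def h[of a c] f[of a c] h[of a d] f[of a d] h[of b c] f[of b c]
      h[of b d] f[of b d] by (simp add: algebra_simps)
  show "odot_antisym h f a b c d + odot_antisym h f a c d b + odot_antisym h f a d b c = 0"
    unfolding odot_antisym_def h[of b c] f[of b c] h[of b d] f[of b d] h[of c d] f[of c d]
    by (simp add: algebra_simps)
qed

lemma riemann_symmetric_odot_sym:
  assumes "bilinear Q" "bilinear k" and Q: "\<And>a b. Q b a = Q a b" and k: "\<And>a b. k b a = k a b"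
  shows "riemann_symmetric (odot_sym Q k)"
  unfolding riemann_symmetric_iff
proof (intro conjI allI)
  note lin = bilinear_ladd[OF assms(1)] bilinear_radd[OF assms(1)] bilinear_ladd[OF assms(2)]
    bilinear_radd[OF assms(2)] bilinear_lmul[OF assms(1)] bilinear_rmul[OF assms(1)]
    bilinear_lmul[OF assms(2)] bilinear_rmul[OF assms(2)]
  show "multilinear4 (odot_sym Q k)"
    unfolding multilinear4_def linear_iff odot_sym_def by (simp add: lin algebra_simps add_divide_distrib)
  fix a b c d
  show "odot_sym Q k b a c d = - odot_sym Q k a b c d"
    unfolding odot_sym_def by (simp add: algebra_simps)
  show "odot_sym Q k a b d c = - odot_sym Q k a b c d"
    unfolding odot_sym_def by (simp add: algebra_simps)
  show "odot_sym Q k c d a b = odot_sym Q k a b c d"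
    unfolding odot_sym_def Q[of a c] k[of a c] Q[of a d] k[of a d] Q[of b c] k[of b c]
      Q[of b d] k[of b d] by (simp add: algebra_simps)
  show "odot_sym Q k a b c d + odot_sym Q k a c d b + odot_sym Q k a d b c = 0"
    unfolding odot_sym_def Q[of b c] k[of b c] Q[of b d] k[of b d] Q[of c d] k[of c d]
    by (simp add: algebra_simps)
qed

lemma bilinear_forms:
  "bilinear (h_form e e' \<mu>)" "bilinear (Q_form e e' \<mu>)" "bilinear (Q_eps \<epsilon>)"
  by (auto simp: bilinear_def linear_iff h_form_def Q_form_def Q_eps_def inner_simps algebra_simps)

lemma riemann_symmetric_zero_weight_form:
  "riemann_symmetric (zero_weight_form n \<epsilon> e e' \<Omega> \<alpha> \<alpha>\<^sub>\<epsilon>)"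
proof -
  have hh: "riemann_symmetric (odot_antisym (h_form e e' \<mu>) (h_form e e' \<nu>))" for \<mu> \<nu>
    by (rule riemann_symmetric_odot_antisym) (auto simp: bilinear_forms, auto simp: h_form_def)
  have QQ: "riemann_symmetric (odot_sym (Q_form e e' \<mu>) (Q_form e e' \<nu>))" for \<mu> \<nu>
    by (rule riemann_symmetric_odot_sym) (auto simp: bilinear_forms, auto simp: Q_form_def)
  have Qg: "riemann_symmetric (odot_sym (Q_form e e' \<mu>) (Q_eps \<epsilon>))" for \<mu>
    by (rule riemann_symmetric_odot_sym)
      (auto simp: bilinear_forms, auto simp: Q_form_def Q_eps_def inner_commute)
  show ?thesis
    unfolding zero_weight_form_def[abs_def]
    by (intro riemann_symmetric_add riemann_symmetric_sum riemann_symmetric_scale hh QQ Qg)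
qed

lemma multilinear4_eq_0:
  assumes r: "multilinear4 r" and span: "span F = UNIV"
    and 0: "\<And>a b c d. a \<in> F \<Longrightarrow> b \<in> F \<Longrightarrow> c \<in> F \<Longrightarrow> d \<in> F \<Longrightarrow> r a b c d = 0"
  shows "r a b c d = 0"
proof -
  have lin: "linear (\<lambda>a. r a b c d)" "linear (\<lambda>b. r a b c d)" "linear (\<lambda>c. r a b c d)"
    "linear (\<lambda>d. r a b c d)" for a b c d
    using r unfolding multilinear4_def by blast+
  have 1: "r a b c d = 0" if "b \<in> F" "c \<in> F" "d \<in> F" for a b c d
    using linear_eq_0_on_span[OF lin(1), of F b c d a] that 0 span by auto
  have 2: "r a b c d = 0" if "c \<in> F" "d \<in> F" for a b c d
    using linear_eq_0_on_span[OF lin(2), of F a c d b] that 1 span by auto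
  have 3: "r a b c d = 0" if "d \<in> F" for a b c d
    using linear_eq_0_on_span[OF lin(3), of F a b d c] that 2 span by auto
  show ?thesis
    using linear_eq_0_on_span[OF lin(4), of F a b c d] 3 span by auto
qed

lemma bilinear_eq_0:
  assumes H: "bilinear H" and span: "span F = UNIV"
    and 0: "\<And>a b. a \<in> F \<Longrightarrow> b \<in> F \<Longrightarrow> H a b = 0"
  shows "H a b = 0"
proof -
  have lin: "linear (\<lambda>a. H a b)" "linear (\<lambda>b. H a b)" for a b
    using H unfolding bilinear_def by blast+
  have 1: "H a b = 0" if "b \<in> F" for a b
    using linear_eq_0_on_span[OF lin(1), of F b a] that 0 span by auto
  show ?thesis
    using linear_eq_0_on_span[OF lin(2), of F a b] 1 span by auto
qed

section \<open>Invariance of full contractions\<close>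

definition preserves :: "('a \<Rightarrow> 'a) \<Rightarrow> 'a tensor4 \<Rightarrow> bool" where
  "preserves g r \<longleftrightarrow> (\<forall>a b c d. r (g a) (g b) (g c) (g d) = r a b c d)"

text \<open>
  The trace does not depend on the orthonormal basis: expanding \<open>g x\<close> in \<open>Basis\<close> produces the matrix
  of \<open>g\<close> times its transpose.
\<close>

lemma trace_orthogonal_invariant:
  fixes \<beta> :: "'a::euclidean_space \<Rightarrow> 'a \<Rightarrow> real" and g :: "'a \<Rightarrow> 'a"
  assumes \<beta>: "bilinear \<beta>" and g: "orthogonal_transformation g"
  shows "(\<Sum>x\<in>Basis. \<beta> (g x) (g x)) = (\<Sum>x\<in>Basis. \<beta> x x)"
proof -
  have lin: "linear (\<lambda>a. \<beta> a b)" "linear (\<lambda>b. \<beta> a b)" for a b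
    using \<beta> unfolding bilinear_def by blast+
  have expand: "\<beta> v v = (\<Sum>y\<in>Basis. \<Sum>z\<in>Basis. (v \<bullet> y) * (v \<bullet> z) * \<beta> z y)" for v
  proof -
    have "\<beta> v v = \<beta> (\<Sum>y\<in>Basis. (v \<bullet> y) *\<^sub>R y) (\<Sum>z\<in>Basis. (v \<bullet> z) *\<^sub>R z)"
      by (simp add: euclidean_representation)
    then show ?thesis
      unfolding linear_sum[OF lin(1)] linear_cmul[OF lin(1)] linear_sum[OF lin(2)]
        linear_cmul[OF lin(2)] by (simp add: sum_distrib_left mult.assoc)
  qed
  have ginv: "g x \<bullet> y = x \<bullet> inv g y" for x y
  proof -
    have "y = g (inv g y)"
      using orthogonal_transformation_surj[OF g] by (simp add: surj_f_inv_f)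
    then show ?thesis
      using g unfolding orthogonal_transformation_def by metis
  qed
  have inv: "inv g y \<bullet> inv g z = y \<bullet> z" for y z
    using orthogonal_transformation_inv[OF g] unfolding orthogonal_transformation_def by blast
  have "(\<Sum>x\<in>Basis. \<beta> (g x) (g x)) =
      (\<Sum>y\<in>Basis. \<Sum>z\<in>Basis. (\<Sum>x\<in>Basis. (g x \<bullet> y) * (g x \<bullet> z)) * \<beta> z y)"
    unfolding expand[of "g _"] sum_distrib_right
    by (subst sum.swap, rule sum.cong[OF refl], rule sum.swap)
  also have "\<dots> = (\<Sum>y\<in>Basis. \<Sum>z\<in>Basis. (y \<bullet> z) * \<beta> z y)"
  proof -
    have "(\<Sum>x\<in>Basis. (g x \<bullet> y) * (g x \<bullet> z)) = y \<bullet> z" for y z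
    proof -
      have "(\<Sum>x\<in>Basis. (g x \<bullet> y) * (g x \<bullet> z)) = (\<Sum>x\<in>Basis. (inv g y \<bullet> x) * (inv g z \<bullet> x))"
        unfolding ginv by (simp only: inner_commute)
      also have "\<dots> = inv g y \<bullet> inv g z" by (rule euclidean_inner[symmetric])
      finally show ?thesis by (simp only: inv)
    qed
    then show ?thesis by simp
  qed
  also have "\<dots> = (\<Sum>x\<in>Basis. \<beta> x x)"
    by (simp add: inner_Basis sum.delta if_distrib[where f = "\<lambda>t. t * _"] cong: if_cong)
  finally show ?thesis .
qed

lemma sum_PiE_insert:
  assumes "finite P" "B \<notin> P"
  shows "(\<Sum>s\<in>insert B P \<rightarrow>\<^sub>E A. F s) = (\<Sum>x\<in>A. \<Sum>s\<in>P \<rightarrow>\<^sub>E A. F (s(B := x)))"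
proof -
  have "(\<Sum>s\<in>insert B P \<rightarrow>\<^sub>E A. F s) = (\<Sum>(x, s)\<in>A \<times> (P \<rightarrow>\<^sub>E A). F (s(B := x)))"
    unfolding PiE_insert_eq
    using inj_combinator[OF assms(2), of "\<lambda>_. A"]
    by (subst sum.reindex) (auto simp: case_prod_unfold)
  then show ?thesis by (simp add: sum.cartesian_product)
qed

text \<open>
  Independence of the basis for all contractions at once. The induction contracts one pair after the
  other; \<open>F\<close> has to vary, because the vectors already chosen for the other pairs become parameters.
  Restricting to \<open>P\<close> makes the transformed choice extensional again, as the induction needs.
\<close>

lemma sum_contractions_orthogonal_invariant:
  fixes F :: "('i \<Rightarrow> 'a::euclidean_space) \<Rightarrow> real" and g :: "'a \<Rightarrow> 'a"
  assumes g: "orthogonal_transformation g" and "finite P"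
    and "\<And>B s. B \<in> P \<Longrightarrow> \<exists>\<beta>. bilinear \<beta> \<and> (\<forall>x. F (s(B := x)) = \<beta> x x)"
  shows "(\<Sum>s\<in>P \<rightarrow>\<^sub>E Basis. F (\<lambda>B\<in>P. g (s B))) = (\<Sum>s\<in>P \<rightarrow>\<^sub>E Basis. F s)"
  using assms(2,3)
proof (induction P arbitrary: F rule: finite_induct)
  case empty
  then show ?case by simp
next
  case (insert B P)
  have upd: "(\<lambda>B'\<in>insert B P. g ((s(B := x)) B')) = (\<lambda>B'\<in>P. g (s B'))(B := g x)" for s x
    using insert.hyps(2) by (auto simp: restrict_def fun_eq_iff)
  have "(\<Sum>s\<in>insert B P \<rightarrow>\<^sub>E Basis. F (\<lambda>B\<in>insert B P. g (s B)))
      = (\<Sum>x\<in>Basis. \<Sum>s\<in>P \<rightarrow>\<^sub>E Basis. F ((\<lambda>B'\<in>P. g (s B'))(B := g x)))"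
    by (simp only: sum_PiE_insert[OF insert.hyps] upd)
  also have "\<dots> = (\<Sum>x\<in>Basis. \<Sum>s\<in>P \<rightarrow>\<^sub>E Basis. F (s(B := g x)))"
  proof (rule sum.cong[OF refl])
    fix x
    have "\<exists>\<beta>. bilinear \<beta> \<and> (\<forall>y. F ((s(B' := y))(B := g x)) = \<beta> y y)" if "B' \<in> P" for B' s
    proof -
      have "B' \<noteq> B" using that insert.hyps(2) by blast
      show ?thesis
        unfolding fun_upd_twist[OF \<open>B' \<noteq> B\<close>] using insert.prems[of B'] that by blast
    qed
    then show "(\<Sum>s\<in>P \<rightarrow>\<^sub>E Basis. F ((\<lambda>B'\<in>P. g (s B'))(B := g x)))
        = (\<Sum>s\<in>P \<rightarrow>\<^sub>E Basis. F (s(B := g x)))"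
      by (rule insert.IH)
  qed
  also have "\<dots> = (\<Sum>s\<in>P \<rightarrow>\<^sub>E Basis. \<Sum>x\<in>Basis. F (s(B := g x)))"
    by (rule sum.swap)
  also have "\<dots> = (\<Sum>s\<in>P \<rightarrow>\<^sub>E Basis. \<Sum>x\<in>Basis. F (s(B := x)))"
  proof (rule sum.cong[OF refl])
    fix s
    obtain \<beta> where "bilinear \<beta>" "\<And>x. F (s(B := x)) = \<beta> x x"
      using insert.prems[of B s] by blast
    then show "(\<Sum>x\<in>Basis. F (s(B := g x))) = (\<Sum>x\<in>Basis. F (s(B := x)))"
      using trace_orthogonal_invariant[OF _ g] by simp
  qed
  also have "\<dots> = (\<Sum>x\<in>Basis. \<Sum>s\<in>P \<rightarrow>\<^sub>E Basis. F (s(B := x)))"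
    by (rule sum.swap)
  also have "\<dots> = (\<Sum>s\<in>insert B P \<rightarrow>\<^sub>E Basis. F s)"
    by (simp only: sum_PiE_insert[OF insert.hyps])
  finally show ?case .
qed

text \<open>
  The uncontracted product \<open>R \<otimes> \<dots> \<otimes> R\<close>, evaluated on vectors indexed by slots. Separating it from
  \<open>slot_vector\<close> lets linearity in a slot be stated with function update.
\<close>

definition tensor_power :: "'a tensor4 \<Rightarrow> nat \<Rightarrow> (nat \<Rightarrow> 'a) \<Rightarrow> real" where
  "tensor_power R k v = (\<Prod>j<k. R (v (4 * j)) (v (4 * j + 1)) (v (4 * j + 2)) (v (4 * j + 3)))"

lemma contracted_product_tensor_power:
  "contracted_product R k p q P a b =
     (\<Sum>s\<in>P \<rightarrow>\<^sub>E Basis. tensor_power R k (slot_vector p q P a b s))"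
  by (simp add: contracted_product_def tensor_power_def)

lemma tensor_power_cong:
  assumes "\<And>i. i < 4 * k \<Longrightarrow> v i = w i"
  shows "tensor_power R k v = tensor_power R k w"
  unfolding tensor_power_def by (intro prod.cong refl) (simp add: assms)

lemma linear_tensor_power:
  fixes R :: "'a::real_vector tensor4"
  assumes R: "multilinear4 R" and i: "i < 4 * k"
  shows "linear (\<lambda>x. tensor_power R k (v(i := x)))"
proof -
  let ?f = "\<lambda>w j. R (w (4 * j)) (w (4 * j + 1)) (w (4 * j + 2)) (w (4 * j + 3))"
  define j where "j = i div 4"
  have j: "j < k" using i unfolding j_def by simp
  have "i = 4 * j + i mod 4" "i mod 4 < 4" unfolding j_def by auto
  then consider "i = 4 * j" | "i = 4 * j + 1" | "i = 4 * j + 2" | "i = 4 * j + 3" by linarith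
  then have lin: "linear (\<lambda>x. ?f (v(i := x)) j)"
    using R unfolding multilinear4_def by cases auto
  have rest: "?f (v(i := x)) l = ?f v l" if "l \<noteq> j" for x l
  proof -
    have "4 * l \<noteq> i" "4 * l + 1 \<noteq> i" "4 * l + 2 \<noteq> i" "4 * l + 3 \<noteq> i"
      using that unfolding j_def by auto
    then show ?thesis by simp
  qed
  have "tensor_power R k (v(i := x)) = (\<Prod>l\<in>{..<k} - {j}. ?f v l) * ?f (v(i := x)) j" for x
  proof -
    have "tensor_power R k (v(i := x)) = ?f (v(i := x)) j * (\<Prod>l\<in>{..<k} - {j}. ?f (v(i := x)) l)"
      unfolding tensor_power_def by (rule prod.remove) (use j in auto)
    also have "(\<Prod>l\<in>{..<k} - {j}. ?f (v(i := x)) l) = (\<Prod>l\<in>{..<k} - {j}. ?f v l)"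
      by (intro prod.cong refl rest) auto
    finally show ?thesis by (simp only: mult.commute)
  qed
  then show ?thesis
    using linear_mult_const[OF lin] by simp
qed

lemma slot_vector_contracted:
  assumes P: "partition_on A P" and "B \<in> P" "i \<in> B" "i \<noteq> p" "i \<noteq> q"
  shows "slot_vector p q P a b s i = s B"
proof -
  have "(THE B. B \<in> P \<and> i \<in> B) = B"
    using assms partition_onD2[OF P] unfolding disjoint_def by (intro the_equality) auto
  then show ?thesis using assms by (simp add: slot_vector_def)
qed

lemma bilinear_contracted_product:
  fixes R :: "'a::euclidean_space tensor4"
  assumes R: "multilinear4 R" and "p < 4 * k" "q < 4 * k" "p \<noteq> q"
  shows "bilinear (contracted_product R k p q P)"
proof -
  have p: "slot_vector p q P a b s = (slot_vector p q P 0 b s)(p := a)"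
    and q: "slot_vector p q P a b s = (slot_vector p q P a 0 s)(q := b)" for a b :: 'a and s
    using assms(4) by (auto simp: slot_vector_def fun_eq_iff)
  show ?thesis
    unfolding bilinear_def contracted_product_tensor_power
  proof (intro conjI allI linear_compose_sum ballI)
    fix a b :: 'a and s
    show "linear (\<lambda>b. tensor_power R k (slot_vector p q P a b s))"
      by (subst q) (rule linear_tensor_power[OF assms(1,3)])
    show "linear (\<lambda>a. tensor_power R k (slot_vector p q P a b s))"
      by (subst p) (rule linear_tensor_power[OF assms(1,2)])
  qed
qed

text \<open>
  Both slots of a contracted pair are linear slots of the tensor power, so the pair is traced over
  a bilinear form and the basis may be replaced by its image under \<open>g\<close>. Then \<open>g\<close> sits in every slot
  and the invariance of \<open>R\<close> removes it factor by factor.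
\<close>

lemma contracted_product_invariant:
  fixes R :: "'a::euclidean_space tensor4"
  assumes R: "multilinear4 R" and P: "pairing ({..<4 * k} - {p, q}) P"
    and g: "orthogonal_transformation g" "preserves g R"
  shows "contracted_product R k p q P (g a) (g b) = contracted_product R k p q P a b"
proof -
  let ?A = "{..<4 * k} - {p, q}"
  have part: "partition_on ?A P" and two: "\<And>B. B \<in> P \<Longrightarrow> card B = 2"
    using P unfolding pairing_def by auto
  have finP: "finite P"
    using finite_elements[OF _ part] by simp
  have "contracted_product R k p q P (g a) (g b)
      = (\<Sum>s\<in>P \<rightarrow>\<^sub>E Basis. tensor_power R k (slot_vector p q P (g a) (g b) (\<lambda>B\<in>P. g (s B))))"
    unfolding contracted_product_tensor_power
  proof (rule sum_contractions_orthogonal_invariant[OF g(1) finP, symmetric])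
    fix B and s :: "nat set \<Rightarrow> 'a" assume B: "B \<in> P"
    obtain i j where ij: "B = {i, j}" "i \<noteq> j"
      using two[OF B] by (auto simp: card_2_iff)
    have BA: "B \<subseteq> ?A"
      using partition_onD1[OF part] B by blast
    let ?v = "slot_vector p q P (g a) (g b) s"
    define \<beta> where "\<beta> x y = tensor_power R k (?v(i := x, j := y))" for x y
    have "bilinear \<beta>"
      unfolding bilinear_def \<beta>_def
    proof (intro conjI allI)
      fix x y
      show "linear (\<lambda>y. tensor_power R k (?v(i := x, j := y)))"
        by (rule linear_tensor_power[OF R]) (use BA ij in auto)
      show "linear (\<lambda>x. tensor_power R k (?v(i := x, j := y)))"
        unfolding fun_upd_twist[OF ij(2)]
        by (rule linear_tensor_power[OF R]) (use BA ij in auto)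
    qed
    moreover have "tensor_power R k (slot_vector p q P (g a) (g b) (s(B := x))) = \<beta> x x" for x
      unfolding \<beta>_def
    proof (rule tensor_power_cong)
      fix l assume l: "l < 4 * k"
      show "slot_vector p q P (g a) (g b) (s(B := x)) l = (?v(i := x, j := x)) l"
      proof (cases "l \<in> {p, q}")
        case True
        then show ?thesis using BA ij by (auto simp: slot_vector_def)
      next
        case False
        then obtain C where C: "C \<in> P" "l \<in> C"
          using l partition_onD1[OF part] by blast
        have "l \<in> B \<longleftrightarrow> C = B"
          using C B partition_onD2[OF part] unfolding disjoint_def by blast
        then show ?thesis
          using False ij by (auto simp: slot_vector_contracted[OF part C])
      qed
    qed
    ultimately show "\<exists>\<beta>. bilinear \<beta> \<and>
        (\<forall>x. tensor_power R k (slot_vector p q P (g a) (g b) (s(B := x))) = \<beta> x x)"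
      by blast
  qed
  also have "\<dots> = (\<Sum>s\<in>P \<rightarrow>\<^sub>E Basis. tensor_power R k (\<lambda>i. g (slot_vector p q P a b s i)))"
  proof (intro sum.cong refl tensor_power_cong)
    fix s l assume l: "l < 4 * k"
    show "slot_vector p q P (g a) (g b) (\<lambda>B\<in>P. g (s B)) l = g (slot_vector p q P a b s l)"
    proof (cases "l \<in> {p, q}")
      case True
      then show ?thesis by (auto simp: slot_vector_def)
    next
      case False
      then obtain C where C: "C \<in> P" "l \<in> C"
        using l partition_onD1[OF part] by blast
      then show ?thesis
        using False by (simp add: slot_vector_contracted[OF part C])
    qed
  qed
  also have "\<dots> = contracted_product R k p q P a b"
    using g(2) by (simp add: contracted_product_tensor_power tensor_power_def preserves_def)
  finally show ?thesis .
qed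

lemma constructed_from_bilinear:
  assumes R: "multilinear4 R" and H: "constructed_from R H"
  shows "bilinear H"
proof -
  obtain m :: nat and c M where M: "\<And>i. i < m \<Longrightarrow> covariant_monomial R (M i)"
    and H: "\<And>a b. H a b = (\<Sum>i<m. c i * M i a b)"
    using H unfolding constructed_from_def by blast
  have "bilinear (M i)" if "i < m" for i
    using M[OF that] bilinear_contracted_product[OF R] unfolding covariant_monomial_def by metis
  then show ?thesis
    unfolding bilinear_def H
    by (auto intro!: linear_compose_sum linear_mult_const)
qed

lemma constructed_from_invariant:
  assumes R: "multilinear4 R" and H: "constructed_from R H"
    and g: "orthogonal_transformation g" "preserves g R"
  shows "H (g a) (g b) = H a b"
proof -
  obtain m :: nat and c M where M: "\<And>i. i < m \<Longrightarrow> covariant_monomial R (M i)"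
    and H: "\<And>a b. H a b = (\<Sum>i<m. c i * M i a b)"
    using H unfolding constructed_from_def by blast
  have "M i (g a) (g b) = M i a b" if "i < m" for i
    using M[OF that] contracted_product_invariant[OF R _ g] unfolding covariant_monomial_def by metis
  then show ?thesis unfolding H by simp
qed


section \<open>Adapted frames and their symmetries\<close>

locale adapted_frame =
  fixes n \<epsilon> :: nat and e e' :: "nat \<Rightarrow> 'a::euclidean_space"
  assumes frame: "orthonormal_frame n \<epsilon> e e'" and eps: "\<epsilon> \<in> {0, 1}"
begin

lemma hat_rangeI: "\<mu> \<in> {1..n} \<Longrightarrow> \<mu> \<in> hat_range n \<epsilon>" "\<epsilon> \<noteq> 0 \<Longrightarrow> 0 \<in> hat_range n \<epsilon>"
  by (auto simp: hat_range_def)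

lemma frame_inner:
  "\<mu> \<in> {1..n} \<Longrightarrow> \<nu> \<in> {1..n} \<Longrightarrow> e \<mu> \<bullet> e \<nu> = (if \<mu> = \<nu> then 1 else 0)"
  "\<mu> \<in> hat_range n \<epsilon> \<Longrightarrow> \<nu> \<in> hat_range n \<epsilon> \<Longrightarrow> e' \<mu> \<bullet> e' \<nu> = (if \<mu> = \<nu> then 1 else 0)"
  "\<mu> \<in> {1..n} \<Longrightarrow> \<nu> \<in> hat_range n \<epsilon> \<Longrightarrow> e \<mu> \<bullet> e' \<nu> = 0"
  "\<mu> \<in> {1..n} \<Longrightarrow> \<nu> \<in> hat_range n \<epsilon> \<Longrightarrow> e' \<nu> \<bullet> e \<mu> = 0"
  using frame unfolding orthonormal_frame_def by (auto simp: inner_commute)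

text \<open>
  The frame vectors grouped by their index. Index \<open>0\<close> has the single vector \<open>e' 0\<close>, and none if \<open>\<epsilon> = 0\<close>,
  so that the indices \<open>0, \<dots>, n\<close> can be treated alike.
\<close>

definition plane :: "nat \<Rightarrow> 'a set" where
  "plane \<mu> = (if \<mu> = 0 then (if \<epsilon> = 0 then {} else {e' 0}) else {e \<mu>, e' \<mu>})"

lemma span_planes: "span (\<Union>\<mu>\<le>n. plane \<mu>) = UNIV"
proof -
  let ?F = "e ` {1..n} \<union> e' ` hat_range n \<epsilon>"
  have inj: "inj_on e {1..n}" "inj_on e' (hat_range n \<epsilon>)"
    by (rule inj_onI, rule ccontr, metis frame_inner(1) zero_neq_one)
      (rule inj_onI, rule ccontr, metis frame_inner(2) zero_neq_one)
  have disj: "e ` {1..n} \<inter> e' ` hat_range n \<epsilon> = {}"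
  proof -
    have "e \<mu> \<noteq> e' \<nu>" if "\<mu> \<in> {1..n}" "\<nu> \<in> hat_range n \<epsilon>" for \<mu> \<nu>
      using frame_inner(1)[OF that(1,1)] frame_inner(3)[OF that] by auto
    then show ?thesis by blast
  qed
  have fin: "finite (hat_range n \<epsilon>)" by (simp add: hat_range_def)
  have card: "card ?F = DIM('a)"
    using frame eps inj disj fin unfolding orthonormal_frame_def
    by (auto simp: card_Un_disjoint card_image hat_range_def)
  have "pairwise orthogonal ?F"
    unfolding pairwise_def orthogonal_def by (auto simp: frame_inner)
  moreover have "0 \<notin> ?F"
    by (metis (no_types, lifting) Un_iff frame_inner(1,2) imageE inner_zero_left zero_neq_one)
  ultimately have "independent ?F" by (rule pairwise_orthogonal_independent)
  then have "span ?F = UNIV"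
    using card_ge_dim_independent[of ?F UNIV] card by auto
  moreover have "?F \<subseteq> (\<Union>\<mu>\<le>n. plane \<mu>)"
  proof -
    have "e \<mu> \<in> plane \<mu>" if "\<mu> \<in> {1..n}" for \<mu>
      using that by (simp add: plane_def)
    moreover have "e' \<mu> \<in> plane \<mu>" "\<mu> \<le> n" if "\<mu> \<in> hat_range n \<epsilon>" for \<mu>
      using that by (auto simp: plane_def hat_range_def split: if_splits)
    ultimately show ?thesis by fastforce
  qed
  ultimately show ?thesis using span_mono by blast
qed

text \<open>
  The rotation by a right angle, \<open>e \<mu> \<mapsto> e' \<mu> \<mapsto> - e \<mu>\<close>, which leaves the other frame vectors alone. One
  angle is enough: the square supplies the sign changes that separate different planes, and the
  forms on a plane invariant under it are already combinations of \<open>Q\<^sub>\<mu>\<close> and \<open>h\<^sub>\<mu>\<close>.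
\<close>

definition quarter_turn :: "nat \<Rightarrow> 'a \<Rightarrow> 'a" where
  "quarter_turn \<mu> x = x - (e \<mu> \<bullet> x) *\<^sub>R e \<mu> - (e' \<mu> \<bullet> x) *\<^sub>R e' \<mu>
     + (e \<mu> \<bullet> x) *\<^sub>R e' \<mu> - (e' \<mu> \<bullet> x) *\<^sub>R e \<mu>"

lemma quarter_turn_minus: "quarter_turn \<mu> (- x) = - quarter_turn \<mu> x"
  by (simp add: quarter_turn_def algebra_simps)

lemma quarter_turn_frame:
  assumes "\<mu> \<in> {1..n}"
  shows "\<nu> \<in> {1..n} \<Longrightarrow> quarter_turn \<mu> (e \<nu>) = (if \<nu> = \<mu> then e' \<mu> else e \<nu>)"
    and "\<nu> \<in> hat_range n \<epsilon> \<Longrightarrow> quarter_turn \<mu> (e' \<nu>) = (if \<nu> = \<mu> then - e \<mu> else e' \<nu>)"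
  using assms hat_rangeI(1)[of \<mu>] by (auto simp: quarter_turn_def frame_inner)

lemma inner_quarter_turn:
  assumes "\<mu> \<in> {1..n}"
  shows "\<nu> \<in> {1..n} \<Longrightarrow> e \<nu> \<bullet> quarter_turn \<mu> x = (if \<nu> = \<mu> then - (e' \<mu> \<bullet> x) else e \<nu> \<bullet> x)"
    and "\<nu> \<in> hat_range n \<epsilon> \<Longrightarrow> e' \<nu> \<bullet> quarter_turn \<mu> x = (if \<nu> = \<mu> then e \<mu> \<bullet> x else e' \<nu> \<bullet> x)"
  using assms hat_rangeI(1)[of \<mu>]
  by (auto simp: quarter_turn_def frame_inner inner_add_right inner_diff_right)

lemma quarter_turn_twice:
  assumes "\<mu> \<in> {1..n}" "\<nu> \<le> n" "x \<in> plane \<nu>"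
  shows "quarter_turn \<mu> (quarter_turn \<mu> x) = (if \<nu> = \<mu> then - x else x)"
  using assms hat_rangeI
  by (auto simp: plane_def quarter_turn_frame quarter_turn_minus split: if_splits)

lemma orthogonal_quarter_turn:
  assumes "\<mu> \<in> {1..n}"
  shows "orthogonal_transformation (quarter_turn \<mu>)"
  unfolding orthogonal_transformation_def
proof (intro conjI allI)
  show "linear (quarter_turn \<mu>)"
    by (simp add: linear_iff quarter_turn_def inner_add_right algebra_simps)
  fix x y
  have "quarter_turn \<mu> x \<bullet> quarter_turn \<mu> y = x \<bullet> quarter_turn \<mu> y
      + ((e \<mu> \<bullet> x) * (e' \<mu> \<bullet> quarter_turn \<mu> y) - (e \<mu> \<bullet> x) * (e \<mu> \<bullet> quarter_turn \<mu> y)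
      - (e' \<mu> \<bullet> x) * (e' \<mu> \<bullet> quarter_turn \<mu> y) - (e' \<mu> \<bullet> x) * (e \<mu> \<bullet> quarter_turn \<mu> y))"
    unfolding quarter_turn_def[of \<mu> x] by (simp add: inner_add_left inner_diff_left)
  also have "\<dots> = x \<bullet> y"
    unfolding inner_quarter_turn(1)[OF assms assms] inner_quarter_turn(2)[OF assms hat_rangeI(1)[OF assms]]
    by (simp add: quarter_turn_def inner_add_right inner_diff_right inner_commute algebra_simps)
  finally show "quarter_turn \<mu> x \<bullet> quarter_turn \<mu> y = x \<bullet> y" .
qed

definition hat_reflection :: "'a \<Rightarrow> 'a" where
  "hat_reflection x = x - 2 *\<^sub>R (\<Sum>\<nu>\<in>{1..n}. (e' \<nu> \<bullet> x) *\<^sub>R e' \<nu>)"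

lemma inner_hat_reflection:
  assumes "\<mu> \<in> {1..n}"
  shows "e \<mu> \<bullet> hat_reflection x = e \<mu> \<bullet> x" "e' \<mu> \<bullet> hat_reflection x = - (e' \<mu> \<bullet> x)"
proof -
  have "(\<Sum>\<nu>\<in>{1..n}. (e' \<nu> \<bullet> x) * (e \<mu> \<bullet> e' \<nu>)) = 0"
    using assms hat_rangeI(1) by (intro sum.neutral) (simp add: frame_inner)
  then show "e \<mu> \<bullet> hat_reflection x = e \<mu> \<bullet> x"
    by (simp add: hat_reflection_def inner_diff_right inner_sum_right)
  have "(\<Sum>\<nu>\<in>{1..n}. (e' \<nu> \<bullet> x) * (e' \<mu> \<bullet> e' \<nu>)) = (\<Sum>\<nu>\<in>{1..n}. if \<mu> = \<nu> then e' \<nu> \<bullet> x else 0)"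
    using assms hat_rangeI(1) by (intro sum.cong refl) (simp add: frame_inner)
  then show "e' \<mu> \<bullet> hat_reflection x = - (e' \<mu> \<bullet> x)"
    using assms by (simp add: hat_reflection_def inner_diff_right inner_sum_right)
qed

lemma hat_reflection_frame:
  assumes "\<mu> \<in> {1..n}"
  shows "hat_reflection (e \<mu>) = e \<mu>" "hat_reflection (e' \<mu>) = - e' \<mu>"
proof -
  have "(\<Sum>\<nu>\<in>{1..n}. (e' \<nu> \<bullet> e \<mu>) *\<^sub>R e' \<nu>) = 0"
    using assms hat_rangeI(1) by (intro sum.neutral) (simp add: frame_inner)
  then show "hat_reflection (e \<mu>) = e \<mu>" by (simp add: hat_reflection_def)
  have "(\<Sum>\<nu>\<in>{1..n}. (e' \<nu> \<bullet> e' \<mu>) *\<^sub>R e' \<nu>) = (\<Sum>\<nu>\<in>{1..n}. if \<nu> = \<mu> then e' \<nu> else 0)"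
    using assms hat_rangeI(1) by (intro sum.cong refl) (simp add: frame_inner)
  then show "hat_reflection (e' \<mu>) = - e' \<mu>"
    using assms by (simp add: hat_reflection_def scaleR_2)
qed

lemma orthogonal_hat_reflection: "orthogonal_transformation hat_reflection"
  unfolding orthogonal_transformation_def
proof (intro conjI allI)
  show "linear hat_reflection"
    by (simp add: linear_iff hat_reflection_def inner_add_right algebra_simps sum.distrib scaleR_sum_right)
  fix x y
  have "hat_reflection x \<bullet> hat_reflection y =
      x \<bullet> hat_reflection y - 2 * (\<Sum>\<nu>\<in>{1..n}. (e' \<nu> \<bullet> x) * (e' \<nu> \<bullet> hat_reflection y))"
    unfolding hat_reflection_def[of x] by (simp add: inner_diff_left inner_sum_left)
  also have "(\<Sum>\<nu>\<in>{1..n}. (e' \<nu> \<bullet> x) * (e' \<nu> \<bullet> hat_reflection y))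
      = - (\<Sum>\<nu>\<in>{1..n}. (e' \<nu> \<bullet> x) * (e' \<nu> \<bullet> y))"
    unfolding sum_negf[symmetric] by (intro sum.cong refl) (simp add: inner_hat_reflection)
  also have "x \<bullet> hat_reflection y = x \<bullet> y - 2 * (\<Sum>\<nu>\<in>{1..n}. (e' \<nu> \<bullet> x) * (e' \<nu> \<bullet> y))"
    unfolding hat_reflection_def
    by (simp add: inner_diff_right inner_sum_right inner_commute mult.commute)
  finally show "hat_reflection x \<bullet> hat_reflection y = x \<bullet> y" by simp
qed

section \<open>Invariance of the tensors of zero weight\<close>

text \<open>
  The form is of even degree in the \<open>h\<^sub>\<mu>\<close>, so a common sign \<open>s\<close> is allowed. The quarter turns use
  \<open>s = 1\<close> and the reflection \<open>s = - 1\<close>.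
\<close>

lemma preserves_zero_weight_form:
  assumes g: "orthogonal_transformation g" and "s * s = (1 :: real)"
    and h: "\<And>\<mu> a b. \<mu> \<in> {1..n} \<Longrightarrow> h_form e e' \<mu> (g a) (g b) = s * h_form e e' \<mu> a b"
    and Q: "\<And>\<mu> a b. \<mu> \<in> {1..n} \<Longrightarrow> Q_form e e' \<mu> (g a) (g b) = Q_form e e' \<mu> a b"
  shows "preserves g (zero_weight_form n \<epsilon> e e' \<Omega> \<alpha> \<alpha>\<^sub>\<epsilon>)"
proof -
  have Qg: "Q_eps \<epsilon> (g a) (g b) = Q_eps \<epsilon> a b" for a b
    using g by (simp add: Q_eps_def orthogonal_transformation_def)
  have s: "s = 1 \<or> s = - 1"
    using assms(2) by (simp add: square_eq_1_iff)
  have hh: "odot_antisym (h_form e e' \<mu>) (h_form e e' \<nu>) (g a) (g b) (g c) (g d)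
      = odot_antisym (h_form e e' \<mu>) (h_form e e' \<nu>) a b c d"
    if "\<mu> \<in> {1..n}" "\<nu> \<in> {1..n}" for \<mu> \<nu> a b c d
    using s that by (auto simp: odot_antisym_def h)
  have QQ: "odot_sym (Q_form e e' \<mu>) (Q_form e e' \<nu>) (g a) (g b) (g c) (g d)
      = odot_sym (Q_form e e' \<mu>) (Q_form e e' \<nu>) a b c d"
    if "\<mu> \<in> {1..n}" "\<nu> \<in> {1..n}" for \<mu> \<nu> a b c d
    using that by (simp add: odot_sym_def Q)
  have QQg: "odot_sym (Q_form e e' \<mu>) (Q_eps \<epsilon>) (g a) (g b) (g c) (g d)
      = odot_sym (Q_form e e' \<mu>) (Q_eps \<epsilon>) a b c d"
    if "\<mu> \<in> {1..n}" for \<mu> a b c d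
    using that by (simp add: odot_sym_def Q Qg)
  show ?thesis
    unfolding preserves_def zero_weight_form_def
    by (intro allI arg_cong2[where f = "(+)"] sum.cong refl) (simp_all add: hh QQ QQg)
qed

lemma preserves_quarter_turn_form:
  assumes "\<mu> \<in> {1..n}"
  shows "preserves (quarter_turn \<mu>) (zero_weight_form n \<epsilon> e e' \<Omega> \<alpha> \<alpha>\<^sub>\<epsilon>)"
  by (rule preserves_zero_weight_form[where s = 1])
    (use assms hat_rangeI(1) in \<open>auto simp: orthogonal_quarter_turn h_form_def Q_form_def inner_quarter_turn\<close>)

lemma preserves_hat_reflection_form:
  "preserves hat_reflection (zero_weight_form n \<epsilon> e e' \<Omega> \<alpha> \<alpha>\<^sub>\<epsilon>)"
  by (rule preserves_zero_weight_form[where s = "- 1"])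
    (auto simp: orthogonal_hat_reflection h_form_def Q_form_def inner_hat_reflection)

text \<open>
  The eigenvalue of the pulled-back quarter turn on each basic one-form.
\<close>

definition phase :: "nat \<Rightarrow> factor \<Rightarrow> complex" where
  "phase \<mu> w = (if w = Plus \<mu> then \<i> else if w = Minus \<mu> then - \<i> else 1)"

lemma factor_form_quarter_turn:
  assumes "\<mu> \<in> {1..n}" "w \<in> factors n \<epsilon>"
  shows "factor_form e e' w (quarter_turn \<mu> x) = phase \<mu> w * factor_form e e' w x"
  using assms hat_rangeI
  by (cases w) (auto simp: factors_def phase_def inner_quarter_turn algebra_simps split: if_splits)

lemma prod_phase:
  "prod_list (map (phase \<mu>) w) = \<i> ^ count_list w (Plus \<mu>) * (- \<i>) ^ count_list w (Minus \<mu>)"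
  by (induction w) (auto simp: phase_def)

lemma preserves_quarter_turn_balanced:
  assumes R: "totally_zero_weight n \<epsilon> e e' R" and \<mu>: "\<mu> \<in> {1..n}"
  shows "preserves (quarter_turn \<mu>) R"
  unfolding preserves_def
proof (intro allI)
  fix a b c d
  let ?J = "quarter_turn \<mu>" and ?f = "factor_form e e'"
  obtain z where z: "\<And>a b c d. complex_of_real (R a b c d) =
      (\<Sum>w\<in>balanced_monomials n \<epsilon>. z w * ?f (w ! 0) a * ?f (w ! 1) b * ?f (w ! 2) c * ?f (w ! 3) d)"
    using R unfolding totally_zero_weight_def by blast
  have "z w * ?f (w ! 0) (?J a) * ?f (w ! 1) (?J b) * ?f (w ! 2) (?J c) * ?f (w ! 3) (?J d)
      = z w * ?f (w ! 0) a * ?f (w ! 1) b * ?f (w ! 2) c * ?f (w ! 3) d"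
    if w: "w \<in> balanced_monomials n \<epsilon>" for w
  proof -
    have len: "length w = 4" and fac: "set w \<subseteq> factors n \<epsilon>"
      and bal: "count_list w (Plus \<mu>) = count_list w (Minus \<mu>)"
      using w \<mu> unfolding balanced_monomials_def by auto
    have f: "w ! i \<in> factors n \<epsilon>" if "i < 4" for i
      using fac len that nth_mem by fastforce
    have "w = [w ! 0, w ! 1, w ! 2, w ! 3]"
      using len by (intro nth_equalityI) (auto simp: less_Suc_eq numeral_eq_Suc)
    then have "prod_list (map (phase \<mu>) w)
        = phase \<mu> (w ! 0) * phase \<mu> (w ! 1) * phase \<mu> (w ! 2) * phase \<mu> (w ! 3)"
      by (metis (no_types, lifting) list.map(1,2) mult.assoc mult.right_neutral prod_list.Cons prod_list.Nil)
    moreover have "prod_list (map (phase \<mu>) w) = 1"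
      unfolding prod_phase bal by (simp flip: power_mult_distrib)
    ultimately have one: "phase \<mu> (w ! 0) * phase \<mu> (w ! 1) * phase \<mu> (w ! 2) * phase \<mu> (w ! 3) = 1"
      by simp
    have "z w * ?f (w ! 0) (?J a) * ?f (w ! 1) (?J b) * ?f (w ! 2) (?J c) * ?f (w ! 3) (?J d)
      = (phase \<mu> (w ! 0) * phase \<mu> (w ! 1) * phase \<mu> (w ! 2) * phase \<mu> (w ! 3)) *
        (z w * ?f (w ! 0) a * ?f (w ! 1) b * ?f (w ! 2) c * ?f (w ! 3) d)"
      using f by (simp add: factor_form_quarter_turn[OF \<mu>])
    then show ?thesis unfolding one by simp
  qed
  then have "complex_of_real (R (?J a) (?J b) (?J c) (?J d)) = complex_of_real (R a b c d)"
    unfolding z by (intro sum.cong refl) blast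
  then show "R (?J a) (?J b) (?J c) (?J d) = R a b c d" by simp
qed


end

section \<open>The independent components of a zero-weight curvature tensor\<close>

lemma riemann_symmetric_minus:
  assumes r: "riemann_symmetric r"
  shows "r (- a) b c d = - r a b c d" "r a (- b) c d = - r a b c d"
    "r a b (- c) d = - r a b c d" "r a b c (- d) = - r a b c d"
proof -
  have "linear (\<lambda>a. r a b c d)" "linear (\<lambda>b. r a b c d)" "linear (\<lambda>c. r a b c d)"
    "linear (\<lambda>d. r a b c d)"
    using riemann_symmetricD(1)[OF r] unfolding multilinear4_def by blast+
  note this[THEN linear_neg]
  then show "r (- a) b c d = - r a b c d" "r a (- b) c d = - r a b c d"
    "r a b (- c) d = - r a b c d" "r a b c (- d) = - r a b c d" by simp_all
qed

text \<open>
  A curvature tensor has a single independent component on a plane.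
\<close>

lemma plane_curvature_eq_0:
  assumes r: "riemann_symmetric r" and "r u v u v = 0" and "{a, b, c, d} \<subseteq> {u, v}"
  shows "r a b c d = 0"
proof -
  have skew: "r x x y z = 0" "r y z x x = 0" for x y z
    using riemann_symmetricD(2)[OF r, of x x y z] riemann_symmetricD(3)[OF r, of y z x x] by auto
  have "r v u u v = 0" "r u v v u = 0" "r v u v u = 0"
    using riemann_symmetricD(2)[OF r, of u v u v] riemann_symmetricD(3)[OF r, of u v u v]
      riemann_symmetricD(2)[OF r, of u v v u] assms(2) by auto
  then show ?thesis using assms(2,3) skew by auto
qed

text \<open>
  The hypothesis says that every nonzero value occurs an even number of times among the four. The
  value \<open>0\<close>, the index of the hatted direction on which no quarter turn acts, then does so too.
\<close>

lemma parity_pairing: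
  fixes i j k l :: nat
  assumes "\<And>m. m \<noteq> 0 \<Longrightarrow> ((i = m) = (j = m)) = ((k = m) = (l = m))"
  shows "(i = j \<and> k = l) \<or> (i = k \<and> j = l) \<or> (i = l \<and> j = k)"
  using assms by metis

context adapted_frame
begin

text \<open>
  Half turns kill every frame component in which some index occurs an odd number of times, so the
  indices match in two pairs. Indices matched in the first and in the last two slots leave the \<open>block\<close>
  components, or the \<open>plane\<close> components if all four agree, since each pair of slots is skew. For crossed pairs \<open>(x, y, x', y')\<close>, with \<open>x, x'\<close> in one plane and \<open>y, y'\<close> in
  another, invariance leaves the four products of the metric and the area form of the two planes:
  pair symmetry excludes the two that contain one area form, the product of both area forms is tied to the
  \<open>block\<close> components by the Bianchi identity, and the product of both metrics is a \<open>cross\<close> component.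
  If the index of \<open>y, y'\<close> is \<open>0\<close>, only the metric and the area form of the first plane are possible,
  and the same argument leaves the \<open>zero\<close> component.
\<close>

lemma curvature_eq_0:
  assumes r: "riemann_symmetric r"
    and J: "\<And>\<mu>. \<mu> \<in> {1..n} \<Longrightarrow> preserves (quarter_turn \<mu>) r"
    and plane: "\<And>\<mu>. \<mu> \<in> {1..n} \<Longrightarrow> r (e \<mu>) (e' \<mu>) (e \<mu>) (e' \<mu>) = 0"
    and block: "\<And>\<mu> \<nu>. \<mu> \<in> {1..n} \<Longrightarrow> \<nu> \<in> {\<mu><..n} \<Longrightarrow> r (e \<mu>) (e' \<mu>) (e \<nu>) (e' \<nu>) = 0"
    and cross: "\<And>\<mu> \<nu>. \<mu> \<in> {1..n} \<Longrightarrow> \<nu> \<in> {\<mu><..n} \<Longrightarrow> r (e \<mu>) (e \<nu>) (e \<mu>) (e \<nu>) = 0"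
    and zero: "\<And>\<mu>. \<mu> \<in> {1..n} \<Longrightarrow> \<epsilon> \<noteq> 0 \<Longrightarrow> r (e \<mu>) (e' 0) (e \<mu>) (e' 0) = 0"
  shows "r a b c d = 0"
proof (rule multilinear4_eq_0[OF riemann_symmetricD(1)[OF r] span_planes])
  note skew1 = riemann_symmetricD(2)[OF r] and skew2 = riemann_symmetricD(3)[OF r]
    and pair = riemann_symmetricD(4)[OF r] and bianchi = riemann_symmetricD(5)[OF r]
    and minus = riemann_symmetric_minus[OF r]
  have turn: "r (quarter_turn \<mu> a) (quarter_turn \<mu> b) (quarter_turn \<mu> c) (quarter_turn \<mu> d) = r a b c d"
    if "\<mu> \<in> {1..n}" for \<mu> a b c d
    using J[OF that] unfolding preserves_def by blast
  have diag: "r x x c d = 0" "r c d x x = 0" for x c d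
    using skew1[of x x c d] skew2[of c d x x] by auto
  have fixed: "quarter_turn \<mu> y = y" if "\<mu> \<in> {1..n}" "\<nu> \<le> n" "\<mu> \<noteq> \<nu>" "y \<in> plane \<nu>" for \<mu> \<nu> y
    using that hat_rangeI by (auto simp: plane_def quarter_turn_frame split: if_splits)
  have turned: "quarter_turn \<mu> (e \<mu>) = e' \<mu>" "quarter_turn \<mu> (e' \<mu>) = - e \<mu>" if "\<mu> \<in> {1..n}" for \<mu>
    using that hat_rangeI(1) by (auto simp: quarter_turn_frame)
  have rot: "r (e' \<mu>) y (e' \<mu>) y' = r (e \<mu>) y (e \<mu>) y'" "r (e' \<mu>) y (e \<mu>) y' = - r (e \<mu>) y (e' \<mu>) y'"
    if "\<mu> \<in> {1..n}" "\<nu> \<le> n" "\<mu> \<noteq> \<nu>" "y \<in> plane \<nu>" "y' \<in> plane \<nu>" for \<mu> \<nu> y y'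
  proof -
    have fx: "quarter_turn \<mu> y = y" "quarter_turn \<mu> y' = y'" using fixed that by blast+
    show "r (e' \<mu>) y (e' \<mu>) y' = r (e \<mu>) y (e \<mu>) y'"
      using turn[OF that(1), of "e \<mu>" y "e \<mu>" y'] by (simp add: fx turned[OF that(1)])
    show "r (e' \<mu>) y (e \<mu>) y' = - r (e \<mu>) y (e' \<mu>) y'"
      using turn[OF that(1), of "e \<mu>" y "e' \<mu>" y'] by (simp add: fx turned[OF that(1)] minus)
  qed
  have rot': "r x (e' \<nu>) x' (e' \<nu>) = r x (e \<nu>) x' (e \<nu>)" "r x (e' \<nu>) x' (e \<nu>) = - r x (e \<nu>) x' (e' \<nu>)"
    if "\<nu> \<in> {1..n}" "\<mu> \<le> n" "\<mu> \<noteq> \<nu>" "x \<in> plane \<mu>" "x' \<in> plane \<mu>" for \<mu> \<nu> x x'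
    using rot[OF that(1,2) _ that(4,5)] that(3) skew1[of _ x _ x'] skew2[of x _ x' _]
      skew1[of _ x x' _] by auto
  have cross': "r (e \<mu>) (e \<nu>) (e \<mu>) (e \<nu>) = 0" if "\<mu> \<in> {1..n}" "\<nu> \<in> {1..n}" "\<mu> \<noteq> \<nu>" for \<mu> \<nu>
  proof (cases "\<mu> < \<nu>")
    case True
    then show ?thesis using cross that by auto
  next
    case False
    then have "r (e \<nu>) (e \<mu>) (e \<nu>) (e \<mu>) = 0" using cross that by auto
    then show ?thesis
      using skew1[of "e \<mu>" "e \<nu>" "e \<mu>" "e \<nu>"] skew2[of "e \<nu>" "e \<mu>" "e \<nu>" "e \<mu>"] by simp
  qed
  have block': "r (e \<mu>) (e' \<mu>) (e \<nu>) (e' \<nu>) = 0" if "\<mu> \<in> {1..n}" "\<nu> \<in> {1..n}" "\<mu> \<noteq> \<nu>" for \<mu> \<nu>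
    using block[of \<mu> \<nu>] block[of \<nu> \<mu>] pair[of "e \<mu>" "e' \<mu>" "e \<nu>" "e' \<nu>"] that
    by (cases "\<mu> < \<nu>") auto

  \<comment> \<open>Pairs in slots 1, 2 and 3, 4.\<close>
  have aligned: "r x x' y y' = 0"
    if "\<mu> \<le> n" "\<nu> \<le> n" "\<mu> \<noteq> \<nu>" "x \<in> plane \<mu>" "x' \<in> plane \<mu>" "y \<in> plane \<nu>" "y' \<in> plane \<nu>"
    for \<mu> \<nu> x x' y y'
  proof (cases "x = x' \<or> y = y'")
    case True
    then show ?thesis using diag by auto
  next
    case False
    then have \<mu>: "\<mu> \<in> {1..n}" and \<nu>: "\<nu> \<in> {1..n}"
      using that by (auto simp: plane_def split: if_splits)
    have 0: "r (e \<mu>) (e' \<mu>) (e \<nu>) (e' \<nu>) = 0" by (rule block'[OF \<mu> \<nu> that(3)])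
    have "(x, x') = (e \<mu>, e' \<mu>) \<or> (x, x') = (e' \<mu>, e \<mu>)" "(y, y') = (e \<nu>, e' \<nu>) \<or> (y, y') = (e' \<nu>, e \<nu>)"
      using that False \<mu> \<nu> by (auto simp: plane_def)
    then show ?thesis
      using 0 skew1[of "e \<mu>" "e' \<mu>" "e \<nu>" "e' \<nu>"] skew2[of "e \<mu>" "e' \<mu>" "e \<nu>" "e' \<nu>"]
        skew1[of "e \<mu>" "e' \<mu>" "e' \<nu>" "e \<nu>"] by auto
  qed

  \<comment> \<open>Pairs in slots 1, 3 and 2, 4, where the first plane admits a quarter turn.\<close>
  have mixed_aux: "r x y x' y' = 0"
    if \<mu>: "\<mu> \<in> {1..n}" and \<nu>: "\<nu> \<le> n" "\<mu> \<noteq> \<nu>" and x: "x \<in> plane \<mu>" "x' \<in> plane \<mu>"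
      and y: "y \<in> plane \<nu>" "y' \<in> plane \<nu>" for \<mu> \<nu> x x' y y'
  proof -
    have diag_y: "r (e \<mu>) y (e' \<mu>) y = 0" if "y \<in> plane \<nu>" for y
      using rot(2)[OF \<mu> \<nu> that that] pair[of "e \<mu>" y "e' \<mu>" y] by simp
    have base: "r (e \<mu>) y (e \<mu>) y' = 0 \<and> r (e \<mu>) y (e' \<mu>) y' = 0"
    proof (cases "\<nu> = 0")
      case True
      then have "\<epsilon> \<noteq> 0" "y = e' 0" "y' = e' 0" using y by (auto simp: plane_def split: if_splits)
      then show ?thesis using zero[OF \<mu>] diag_y y by auto
    next
      case False
      then have \<nu>': "\<nu> \<in> {1..n}" using \<nu> by simp
      have in_plane: "e \<mu> \<in> plane \<mu>" "e' \<mu> \<in> plane \<mu>" "e \<nu> \<in> plane \<nu>" "e' \<nu> \<in> plane \<nu>"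
        using \<mu> \<nu>' by (auto simp: plane_def)
      have \<mu>n: "\<mu> \<le> n" using \<mu> by simp
      note rot_\<nu> = rot'[OF \<nu>' \<mu>n \<nu>(2)]
      have 1: "r (e \<mu>) (e \<nu>) (e \<mu>) (e \<nu>) = 0" by (rule cross'[OF \<mu> \<nu>' \<nu>(2)])
      have 2: "r (e \<mu>) (e' \<nu>) (e \<mu>) (e' \<nu>) = 0"
        using rot_\<nu>(1)[OF in_plane(1,1)] 1 by simp
      have 3: "r (e \<mu>) (e' \<nu>) (e \<mu>) (e \<nu>) = 0" "r (e \<mu>) (e \<nu>) (e \<mu>) (e' \<nu>) = 0"
        using rot_\<nu>(2)[OF in_plane(1,1)] pair[of "e \<mu>" "e \<nu>" "e \<mu>" "e' \<nu>"] by auto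
      have 4: "r (e \<mu>) (e' \<nu>) (e' \<mu>) (e \<nu>) = - r (e \<mu>) (e \<nu>) (e' \<mu>) (e' \<nu>)"
        by (rule rot_\<nu>(2)[OF in_plane(1,2)])
      have "r (e \<mu>) (e' \<mu>) (e' \<nu>) (e \<nu>) = 0"
        using aligned \<mu>n \<nu> in_plane by blast
      \<comment> \<open>By 4 the first and the third Bianchi term are equal, so they add up instead of cancelling.\<close>
      then have 5: "r (e \<mu>) (e \<nu>) (e' \<mu>) (e' \<nu>) = 0"
        using bianchi[of "e \<mu>" "e \<nu>" "e' \<mu>" "e' \<nu>"] skew2[of "e \<mu>" "e' \<nu>" "e' \<mu>" "e \<nu>"] 4 by simp
      show ?thesis
        using y False 1 2 3 4 5 diag_y[OF in_plane(3)] diag_y[OF in_plane(4)] by (auto simp: plane_def)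
    qed
    have "x \<in> {e \<mu>, e' \<mu>}" "x' \<in> {e \<mu>, e' \<mu>}" using x \<mu> by (auto simp: plane_def)
    then show ?thesis
      using base rot[OF \<mu> \<nu> y] by auto
  qed

  have mixed: "r x y x' y' = 0"
    if "\<mu> \<le> n" "\<nu> \<le> n" "\<mu> \<noteq> \<nu>" "x \<in> plane \<mu>" "x' \<in> plane \<mu>" "y \<in> plane \<nu>" "y' \<in> plane \<nu>"
    for \<mu> \<nu> x x' y y'
  proof (cases "\<mu> = 0")
    case True
    then have "r y x y' x' = 0" using mixed_aux[of \<nu> \<mu> y y' x x'] that by auto
    then show ?thesis using skew1[of y x y' x'] skew2[of x y y' x'] by simp
  next
    case False
    then show ?thesis using mixed_aux[of \<mu> \<nu> x x' y y'] that by auto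
  qed

  fix a b c d
  assume "a \<in> (\<Union>\<mu>\<le>n. plane \<mu>)" "b \<in> (\<Union>\<mu>\<le>n. plane \<mu>)" "c \<in> (\<Union>\<mu>\<le>n. plane \<mu>)" "d \<in> (\<Union>\<mu>\<le>n. plane \<mu>)"
  then obtain i j k l where le: "i \<le> n" "j \<le> n" "k \<le> n" "l \<le> n"
    and mem: "a \<in> plane i" "b \<in> plane j" "c \<in> plane k" "d \<in> plane l" by blast
  show "r a b c d = 0"
  proof (rule ccontr)
    assume nz: "r a b c d \<noteq> 0"
    \<comment> \<open>A half turn multiplies the component by \<open>-1\<close> for each vector that lies in its plane.\<close>
    have "((i = m) = (j = m)) = ((k = m) = (l = m))"
      if "m \<noteq> 0" for m
    proof (cases "m \<le> n")
      case False
      then show ?thesis using le by auto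
    next
      case True
      then have m: "m \<in> {1..n}" using that by simp
      note twice = quarter_turn_twice[OF m]
      have "r (quarter_turn m (quarter_turn m a)) (quarter_turn m (quarter_turn m b))
          (quarter_turn m (quarter_turn m c)) (quarter_turn m (quarter_turn m d)) = r a b c d"
        by (simp only: turn[OF m])
      then show ?thesis
        unfolding twice[OF le(1) mem(1)] twice[OF le(2) mem(2)] twice[OF le(3) mem(3)] twice[OF le(4) mem(4)]
        using nz by (cases "i = m"; cases "j = m"; cases "k = m"; cases "l = m"; simp add: minus)
    qed
    then consider "i = j" "k = l" | "i = k" "j = l" "i \<noteq> j" | "i = l" "j = k" "i \<noteq> j"
      using parity_pairing[of i j k l] by blast
    then show False
    proof cases
      case 1
      show False
      proof (cases "i = k")
        case True
        show False
        proof (cases "i = 0")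
          case True
          then have "a = b" using mem 1 by (auto simp: plane_def split: if_splits)
          then show False using nz diag by simp
        next
          case False
          then have "{a, b, c, d} \<subseteq> {e i, e' i}" "i \<in> {1..n}"
            using mem le 1 \<open>i = k\<close> by (auto simp: plane_def)
          then show False using nz plane_curvature_eq_0[OF r plane] by blast
        qed
      next
        case False
        then show False using nz aligned[of i k a b c d] mem le 1 by auto
      qed
    next
      case 2
      then show False using nz mixed[of i j a c b d] mem le by auto
    next
      case 3
      then have "r a b d c = 0" using mixed[of i j a d b c] mem le by auto
      then show False using nz skew2[of a b c d] by simp
    qed
  qed
qed

lemma sum_pairs_single:
  fixes f :: "nat \<Rightarrow> nat \<Rightarrow> real"
  assumes "\<kappa> \<in> {1..n}" "l \<in> {\<kappa><..n}"
    and 0: "\<And>\<mu> \<nu>. \<mu> \<in> {1..n} \<Longrightarrow> \<nu> \<in> {\<mu><..n} \<Longrightarrow> \<mu> \<noteq> \<kappa> \<or> \<nu> \<noteq> l \<Longrightarrow> f \<mu> \<nu> = 0"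
  shows "(\<Sum>\<mu>\<in>{1..n}. \<Sum>\<nu>\<in>{\<mu><..n}. f \<mu> \<nu>) = f \<kappa> l"
proof -
  have "(\<Sum>\<mu>\<in>{1..n}. \<Sum>\<nu>\<in>{\<mu><..n}. f \<mu> \<nu>) = (\<Sum>\<mu>\<in>{1..n}. if \<mu> = \<kappa> then f \<kappa> l else 0)"
  proof (intro sum.cong refl)
    fix \<mu> assume \<mu>: "\<mu> \<in> {1..n}"
    have "(\<Sum>\<nu>\<in>{\<mu><..n}. f \<mu> \<nu>) = (\<Sum>\<nu>\<in>{\<mu><..n}. if \<nu> = l then (if \<mu> = \<kappa> then f \<kappa> l else 0) else 0)"
      using 0[OF \<mu>] by (intro sum.cong refl) auto
    then show "(\<Sum>\<nu>\<in>{\<mu><..n}. f \<mu> \<nu>) = (if \<mu> = \<kappa> then f \<kappa> l else 0)"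
      using assms(2) by auto
  qed
  then show ?thesis using assms(1) by simp
qed

text \<open>
  The terms in \<open>\<epsilon>\<close> come from \<open>Q\<^sub>\<epsilon> = \<epsilon> g\<close>, where the metric \<open>g\<close> contains all the \<open>Q\<^sub>\<mu>\<close>: the coefficient
  \<open>\<alpha>\<^sub>\<epsilon>\<close> contributes to the components inside and between the planes as well.
\<close>

lemma form_components:
  fixes \<Omega> \<alpha> :: "nat \<Rightarrow> nat \<Rightarrow> real" and \<alpha>\<^sub>\<epsilon> :: "nat \<Rightarrow> real"
  defines "F \<equiv> zero_weight_form n \<epsilon> e e' \<Omega> \<alpha> \<alpha>\<^sub>\<epsilon>"
  assumes \<kappa>: "\<kappa> \<in> {1..n}"
  shows "F (e \<kappa>) (e' \<kappa>) (e \<kappa>) (e' \<kappa>) = 3/8 * \<Omega> \<kappa> \<kappa> - real \<epsilon> / 4 * \<alpha>\<^sub>\<epsilon> \<kappa>"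
    and "l \<in> {\<kappa><..n} \<Longrightarrow> F (e \<kappa>) (e' \<kappa>) (e l) (e' l) = 1/4 * \<Omega> \<kappa> l"
    and "l \<in> {\<kappa><..n} \<Longrightarrow>
      F (e \<kappa>) (e l) (e \<kappa>) (e l) = - 1/8 * \<alpha> \<kappa> l - real \<epsilon> / 8 * (\<alpha>\<^sub>\<epsilon> \<kappa> + \<alpha>\<^sub>\<epsilon> l)"
    and "\<epsilon> \<noteq> 0 \<Longrightarrow> F (e \<kappa>) (e' 0) (e \<kappa>) (e' 0) = - 1/8 * \<alpha>\<^sub>\<epsilon> \<kappa>"
proof -
  define S1 where "S1 a b c d = (\<Sum>\<mu>\<in>{1..n}. \<Sum>\<nu>\<in>{\<mu><..n}.
        \<Omega> \<mu> \<nu> * odot_antisym (h_form e e' \<mu>) (h_form e e' \<nu>) a b c d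
        + \<alpha> \<mu> \<nu> * odot_sym (Q_form e e' \<mu>) (Q_form e e' \<nu>) a b c d)" for a b c d
  define S2 where "S2 a b c d = (\<Sum>\<mu>\<in>{1..n}.
        1/2 * \<Omega> \<mu> \<mu> * odot_antisym (h_form e e' \<mu>) (h_form e e' \<mu>) a b c d
        + \<alpha>\<^sub>\<epsilon> \<mu> * odot_sym (Q_form e e' \<mu>) (Q_eps \<epsilon>) a b c d)" for a b c d
  have F: "F a b c d = S1 a b c d + S2 a b c d" for a b c d
    by (simp add: F_def zero_weight_form_def S1_def S2_def)
  note ev = odot_antisym_def odot_sym_def h_form_def Q_form_def Q_eps_def frame_inner hat_rangeI
  have "S1 (e \<kappa>) (e' \<kappa>) (e \<kappa>) (e' \<kappa>) = 0"
    unfolding S1_def using \<kappa> by (intro sum.neutral ballI) (auto simp: ev)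
  moreover have "S2 (e \<kappa>) (e' \<kappa>) (e \<kappa>) (e' \<kappa>)
      = (\<Sum>\<mu>\<in>{1..n}. if \<mu> = \<kappa> then 3/8 * \<Omega> \<kappa> \<kappa> - real \<epsilon> / 4 * \<alpha>\<^sub>\<epsilon> \<kappa> else 0)"
    unfolding S2_def using \<kappa> by (intro sum.cong refl) (auto simp: ev mult.commute)
  ultimately show "F (e \<kappa>) (e' \<kappa>) (e \<kappa>) (e' \<kappa>) = 3/8 * \<Omega> \<kappa> \<kappa> - real \<epsilon> / 4 * \<alpha>\<^sub>\<epsilon> \<kappa>"
    using \<kappa> by (simp add: F)
  {
    assume l: "l \<in> {\<kappa><..n}"
    then have l': "l \<in> {1..n}" "l \<noteq> \<kappa>" using \<kappa> by auto
    have "S1 (e \<kappa>) (e' \<kappa>) (e l) (e' l) = 1/4 * \<Omega> \<kappa> l"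
      unfolding S1_def using \<kappa> l' l
      by (subst sum_pairs_single[OF \<kappa> l]) (auto simp: ev)
    moreover have "S2 (e \<kappa>) (e' \<kappa>) (e l) (e' l) = 0"
      unfolding S2_def using \<kappa> l' by (intro sum.neutral ballI) (auto simp: ev)
    ultimately show "F (e \<kappa>) (e' \<kappa>) (e l) (e' l) = 1/4 * \<Omega> \<kappa> l" by (simp add: F)
    have "S1 (e \<kappa>) (e l) (e \<kappa>) (e l) = - 1/8 * \<alpha> \<kappa> l"
      unfolding S1_def using \<kappa> l' l
      by (subst sum_pairs_single[OF \<kappa> l]) (auto simp: ev)
    moreover have "S2 (e \<kappa>) (e l) (e \<kappa>) (e l) = (\<Sum>\<mu>\<in>{1..n}.
        (if \<mu> = \<kappa> then - real \<epsilon> / 8 * \<alpha>\<^sub>\<epsilon> \<kappa> else 0) + (if \<mu> = l then - real \<epsilon> / 8 * \<alpha>\<^sub>\<epsilon> l else 0))"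
      unfolding S2_def using \<kappa> l' by (intro sum.cong refl) (auto simp: ev)
    ultimately show "F (e \<kappa>) (e l) (e \<kappa>) (e l) = - 1/8 * \<alpha> \<kappa> l - real \<epsilon> / 8 * (\<alpha>\<^sub>\<epsilon> \<kappa> + \<alpha>\<^sub>\<epsilon> l)"
      using \<kappa> l' by (simp add: F sum.distrib algebra_simps add_divide_distrib)
  }
  assume "\<epsilon> \<noteq> 0"
  then have \<epsilon>: "\<epsilon> = 1" and zero: "0 \<in> hat_range n \<epsilon>" using eps hat_rangeI(2) by auto
  have "S1 (e \<kappa>) (e' 0) (e \<kappa>) (e' 0) = 0"
    unfolding S1_def using \<kappa> zero by (intro sum.neutral ballI) (auto simp: ev)
  moreover have "S2 (e \<kappa>) (e' 0) (e \<kappa>) (e' 0) = (\<Sum>\<mu>\<in>{1..n}. if \<mu> = \<kappa> then - real \<epsilon> / 8 * \<alpha>\<^sub>\<epsilon> \<kappa> else 0)"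
    unfolding S2_def using \<kappa> zero by (intro sum.cong refl) (auto simp: ev)
  ultimately show "F (e \<kappa>) (e' 0) (e \<kappa>) (e' 0) = - 1/8 * \<alpha>\<^sub>\<epsilon> \<kappa>"
    using \<kappa> \<epsilon> by (simp add: F)
qed

text \<open>
  The components listed in \<open>form_components\<close> are solved for the coefficients: first \<open>\<alpha>\<^sub>\<epsilon>\<close>, then the others.
  The difference of \<open>R\<close> and the form then has no independent component left.
\<close>

theorem zero_weight_form_exists:
  assumes R: "riemann_symmetric R" "totally_zero_weight n \<epsilon> e e' R"
  shows "\<exists>\<Omega> \<alpha> \<alpha>\<^sub>\<epsilon>. R = zero_weight_form n \<epsilon> e e' \<Omega> \<alpha> \<alpha>\<^sub>\<epsilon>"
proof -
  define \<alpha>\<^sub>\<epsilon> where "\<alpha>\<^sub>\<epsilon> \<mu> = - 8 * R (e \<mu>) (e' 0) (e \<mu>) (e' 0)" for \<mu>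
  define \<alpha> where "\<alpha> \<mu> \<nu> = - 8 * R (e \<mu>) (e \<nu>) (e \<mu>) (e \<nu>) - real \<epsilon> * (\<alpha>\<^sub>\<epsilon> \<mu> + \<alpha>\<^sub>\<epsilon> \<nu>)" for \<mu> \<nu>
  define \<Omega> where "\<Omega> \<mu> \<nu> = (if \<mu> = \<nu> then 8/3 * (R (e \<mu>) (e' \<mu>) (e \<mu>) (e' \<mu>) + real \<epsilon> / 4 * \<alpha>\<^sub>\<epsilon> \<mu>)
    else 4 * R (e \<mu>) (e' \<mu>) (e \<nu>) (e' \<nu>))" for \<mu> \<nu>
  let ?F = "zero_weight_form n \<epsilon> e e' \<Omega> \<alpha> \<alpha>\<^sub>\<epsilon>"
  note F = form_components[where \<Omega> = \<Omega> and \<alpha> = \<alpha> and \<alpha>\<^sub>\<epsilon> = \<alpha>\<^sub>\<epsilon>]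
  have "R a b c d + (- 1) * ?F a b c d = 0" for a b c d
  proof (rule curvature_eq_0)
    show "riemann_symmetric (\<lambda>a b c d. R a b c d + (- 1) * ?F a b c d)"
      by (intro riemann_symmetric_add riemann_symmetric_scale R riemann_symmetric_zero_weight_form)
    show "preserves (quarter_turn \<mu>) (\<lambda>a b c d. R a b c d + (- 1) * ?F a b c d)" if "\<mu> \<in> {1..n}" for \<mu>
      using preserves_quarter_turn_balanced[OF R(2) that] preserves_quarter_turn_form[OF that]
      unfolding preserves_def by simp
    fix \<mu> assume \<mu>: "\<mu> \<in> {1..n}"
    show "R (e \<mu>) (e' \<mu>) (e \<mu>) (e' \<mu>) + (- 1) * ?F (e \<mu>) (e' \<mu>) (e \<mu>) (e' \<mu>) = 0"
      unfolding F(1)[OF \<mu>] by (simp add: \<Omega>_def add_divide_distrib)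
    show "R (e \<mu>) (e' 0) (e \<mu>) (e' 0) + (- 1) * ?F (e \<mu>) (e' 0) (e \<mu>) (e' 0) = 0" if "\<epsilon> \<noteq> 0"
      unfolding F(4)[OF \<mu> that] by (simp add: \<alpha>\<^sub>\<epsilon>_def)
    fix \<nu> assume \<nu>: "\<nu> \<in> {\<mu><..n}"
    show "R (e \<mu>) (e' \<mu>) (e \<nu>) (e' \<nu>) + (- 1) * ?F (e \<mu>) (e' \<mu>) (e \<nu>) (e' \<nu>) = 0"
      unfolding F(2)[OF \<mu> \<nu>] using \<nu> by (simp add: \<Omega>_def)
    show "R (e \<mu>) (e \<nu>) (e \<mu>) (e \<nu>) + (- 1) * ?F (e \<mu>) (e \<nu>) (e \<mu>) (e \<nu>) = 0"
      unfolding F(3)[OF \<mu> \<nu>] by (simp add: \<alpha>_def algebra_simps add_divide_distrib diff_divide_distrib)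
  qed
  then have "R = ?F" by (simp add: fun_eq_iff)
  then show ?thesis by blast
qed

text \<open>
  The quarter turns leave the components \<open>H (e i) (e' i)\<close>, which are odd under the reflection.
\<close>

theorem constructed_two_form_eq_0:
  assumes R: "riemann_symmetric R" "totally_zero_weight n \<epsilon> e e' R"
    and H: "constructed_from R H" "antisymmetric2 H"
  shows "H a b = 0"
proof -
  have lin: "multilinear4 R" by (rule riemann_symmetricD(1)[OF R(1)])
  have bil: "bilinear H" by (rule constructed_from_bilinear[OF lin H(1)])
  have minus: "H (- a) b = - H a b" "H a (- b) = - H a b" for a b
    using bil by (simp_all add: bilinear_lneg bilinear_rneg)
  have anti: "H b a = - H a b" for a b
    using H(2) unfolding antisymmetric2_def by blast
  have turn: "H (quarter_turn \<mu> a) (quarter_turn \<mu> b) = H a b" if "\<mu> \<in> {1..n}" for \<mu> a b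
    by (rule constructed_from_invariant[OF lin H(1) orthogonal_quarter_turn[OF that]
          preserves_quarter_turn_balanced[OF R(2) that]])
  have "preserves hat_reflection R"
    using zero_weight_form_exists[OF R] preserves_hat_reflection_form by auto
  then have refl: "H (hat_reflection a) (hat_reflection b) = H a b" for a b
    by (rule constructed_from_invariant[OF lin H(1) orthogonal_hat_reflection])
  show ?thesis
  proof (rule bilinear_eq_0[OF bil span_planes])
    fix a b assume "a \<in> (\<Union>\<mu>\<le>n. plane \<mu>)" "b \<in> (\<Union>\<mu>\<le>n. plane \<mu>)"
    then obtain i j where le: "i \<le> n" "j \<le> n" and mem: "a \<in> plane i" "b \<in> plane j" by blast
    \<comment> \<open>The half turn of plane \<open>m\<close> changes the sign of exactly one argument.\<close>
    have off: "H a b = 0" if m: "m \<in> {1..n}" "(i = m) \<noteq> (j = m)" for m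
    proof -
      have "H (quarter_turn m (quarter_turn m a)) (quarter_turn m (quarter_turn m b)) = H a b"
        by (simp only: turn[OF m(1)])
      then show ?thesis
        unfolding quarter_turn_twice[OF m(1) le(1) mem(1)] quarter_turn_twice[OF m(1) le(2) mem(2)]
        using m(2) by (auto simp: minus split: if_splits)
    qed
    show "H a b = 0"
    proof (cases "i = j")
      case False
      then show ?thesis using off[of i] off[of j] le by (cases "i = 0") auto
    next
      case True
      show ?thesis
      proof (cases "a = b")
        case True
        then show ?thesis using anti[of a a] by simp
      next
        case False
        then have i: "i \<in> {1..n}" and ab: "(a = e i \<and> b = e' i) \<or> (a = e' i \<and> b = e i)"
          using mem \<open>i = j\<close> le by (auto simp: plane_def split: if_splits)
        have "H (e i) (e' i) = 0"
          using refl[of "e i" "e' i"] by (simp add: hat_reflection_frame[OF i] minus)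
        then show ?thesis using ab anti[of "e' i" "e i"] by auto
      qed
    qed
  qed
qed

end

theorem theorem3:
  fixes n \<epsilon> :: nat
    and e e' :: "nat \<Rightarrow> 'a::euclidean_space"
    and R :: "'a tensor4"
    and H :: "'a tensor2"
  assumes "\<epsilon> \<in> {0, 1}"
    and "orthonormal_frame n \<epsilon> e e'"
    and "riemann_symmetric R"
    and "totally_zero_weight n \<epsilon> e e' R"
    and "constructed_from R H"
    and "antisymmetric2 H"
  shows "(\<exists>\<Omega> \<alpha> \<alpha>\<^sub>\<epsilon>. R = zero_weight_form n \<epsilon> e e' \<Omega> \<alpha> \<alpha>\<^sub>\<epsilon>) \<and> (\<forall>a b. H a b = 0)"
proof -
  interpret adapted_frame n \<epsilon> e e'
    by unfold_locales (rule assms)+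
  show ?thesis
    using zero_weight_form_exists[OF assms(3,4)] constructed_two_form_eq_0[OF assms(3-6)] by blast
qed

end
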